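(* Let $R=K[x_1,\ldots,x_n]$ be a polynomial ring over a field $K$ and let $I$ be a (nonzero, proper) square-free monomial ideal in $R$. Put $s_0=\lceil n\,\operatorname{bight}(I)^{(n+2)/2}\rceil$. Then $\operatorname{assrad}(I^{(s)})=\operatorname{assrad}(I^{(s_0)})$ for all integers $s\ge s_0$. In particular, $\operatorname{assrad}(I^{(s)})$ is constant for $s\gg 0$.
   Context: For a monomial ideal $I$ of $R$, $\operatorname{assrad}(I)=\{\sqrt{I:f}\mid f \text{ is a monomial of } R,\ f\notin I\}$ denotes the set of associated radical ideals of $I$. For $s\ge 1$ the $s$-th symbolic power of $I$ is $I^{(s)}=\bigcap_{\mathfrak p\in \operatorname{Min}(I)} (I^sR_{\mathfrak p}\cap R)$, where $\operatorname{Min}(I)$ is the set of minimal primes of $I$. For a square-free monomial ideal $I$, all associated primes are minimal and generated by variables, and if $I=\mathfrak p_1\cap\cdots\cap\mathfrak p_r$ is the minimal primary decomposition then $I^{(s)}=\mathfrak p_1^s\cap\cdots\cap\mathfrak p_r^s$. The big height $\operatorname{bight}(I)$ is the maximum of the heights of the associated primes of $R/I$, i.e. the maximal number of variables generating one of the $\mathfrak p_i$. *)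

theory Defs
  imports
    Complex_Main
    "HOL-Library.Poly_Mapping"
    "HOL-Library.Extended_Nat"
    "HOL-Library.Cardinality"
    "HOL-Computational_Algebra.Fraction_Field"
    "HOL-Algebra.Ideal_Product"
    "HOL-Algebra.Algebraic_Closure_Type"
begin

text \<open>
  The polynomial ring \<open>K[x\<^sub>1,\<dots>,x\<^sub>n]\<close> is the type \<open>('x, 'k) mpoly\<close>, whose variables are indexed by
  the elements of a finite type \<open>'x\<close> with \<open>n = CARD('x)\<close>.  The library makes this type an integral
  domain when \<open>'x\<close> is linearly ordered; the order plays no other role.
\<close>

type_synonym ('x, 'k) mpoly = "('x \<Rightarrow>\<^sub>0 nat) \<Rightarrow>\<^sub>0 'k"

text \<open>
  Ideals, prime ideals, generated ideals and products of ideals are those of HOL-Algebra, applied to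
  the ring structure carried by a type.
\<close>

abbreviation ring_of :: "'a::ring_1 itself \<Rightarrow> 'a ring"
  where "ring_of _ \<equiv> ring_of_type_algebra"

definition ideal_power :: "'a::comm_ring_1 set \<Rightarrow> nat \<Rightarrow> 'a set"
  where "ideal_power I s = I [^]\<^bsub>ideals_set (ring_of TYPE('a))\<^esub> s"

definition colon :: "'a::comm_ring_1 set \<Rightarrow> 'a \<Rightarrow> 'a set"
  where "colon I f = {g. g * f \<in> I}"

definition radical :: "'a::comm_ring_1 set \<Rightarrow> 'a set"
  where "radical I = {g. \<exists>m>0. g ^ m \<in> I}"

definition minimal_primes :: "'a::comm_ring_1 set \<Rightarrow> 'a set set"
  where "minimal_primes I =
    {p. primeideal p (ring_of TYPE('a)) \<and> I \<subseteq> p \<and>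
        (\<forall>q. primeideal q (ring_of TYPE('a)) \<and> I \<subseteq> q \<and> q \<subseteq> p \<longrightarrow> q = p)}"

text \<open>The annihilator in \<open>R/I\<close> of the class of \<open>f\<close> is \<open>I : f\<close>.\<close>

definition associated_primes :: "'a::comm_ring_1 set \<Rightarrow> 'a set set"
  where "associated_primes I =
    {p. primeideal p (ring_of TYPE('a)) \<and> (\<exists>f. p = colon I f)}"

definition height :: "'a::comm_ring_1 set \<Rightarrow> enat"
  where "height p = Sup {enat m | m. \<exists>c :: nat \<Rightarrow> 'a set.
    (\<forall>i\<le>m. primeideal (c i) (ring_of TYPE('a))) \<and> (\<forall>i<m. c i \<subset> c (Suc i)) \<and> c m = p}"

definition bight :: "'a::comm_ring_1 set \<Rightarrow> enat"
  where "bight I = (SUP p\<in>associated_primes I. height p)"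

text \<open>The localization \<open>R\<^sub>p\<close> of a domain at a prime \<open>p\<close>, as a subring of the fraction field.\<close>

definition localization :: "'a::idom set \<Rightarrow> 'a fract ring"
  where "localization p =
    (ring_of TYPE('a fract))\<lparr>carrier := {Fract a g | a g. g \<notin> p}\<rparr>"

definition extend :: "'a::idom set \<Rightarrow> 'a set \<Rightarrow> 'a fract set"
  where "extend p J = Idl\<^bsub>localization p\<^esub> ((\<lambda>a. Fract a 1) ` J)"

definition contract :: "'a::idom fract set \<Rightarrow> 'a set"
  where "contract J = {f. Fract f 1 \<in> J}"

definition symbolic_power :: "'a::idom set \<Rightarrow> nat \<Rightarrow> 'a set"
  where "symbolic_power I s = (\<Inter>p\<in>minimal_primes I. contract (extend p (ideal_power I s)))"

definition monomial :: "('x \<Rightarrow>\<^sub>0 nat) \<Rightarrow> ('x, 'k::comm_ring_1) mpoly"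
  where "monomial a = Poly_Mapping.single a 1"

definition squarefree_monomial_ideal :: "('x, 'k::comm_ring_1) mpoly set \<Rightarrow> bool"
  where "squarefree_monomial_ideal I \<longleftrightarrow>
    (\<exists>A. (\<forall>a\<in>A. \<forall>i. Poly_Mapping.lookup a i \<le> 1) \<and>
         I = Idl\<^bsub>ring_of TYPE(('x, 'k) mpoly)\<^esub> (monomial ` A))"

definition assrad :: "('x, 'k::comm_ring_1) mpoly set \<Rightarrow> ('x, 'k) mpoly set set"
  where "assrad I = {radical (colon I (monomial a)) | a. monomial a \<notin> I}"

end

theory Submission
  imports Defs "HOL-Analysis.Determinants"
begin

text \<open>
  Write \<open>P\<^sub>C\<close> for the prime ideal generated by the variables in \<open>C\<close>, and \<open>a(C)\<close> for the sum of the
  exponents \<open>a\<^sub>i\<close> with \<open>i \<in> C\<close>.  The minimal primes of \<open>I\<close> are the \<open>P\<^sub>C\<close> with \<open>C\<close> in a family of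
  "minimal covers", and locally at such a prime \<open>I\<close> agrees with \<open>P\<^sub>C\<close>, because \<open>I\<close> is square-free.
  So the symbolic power \<open>I\<^sup>(\<^sup>s\<^sup>)\<close> consists of the polynomials all of whose monomials \<open>x\<^sup>a\<close> satisfy
  \<open>a(C) \<ge> s\<close> for every minimal cover \<open>C\<close>, and the radical of \<open>I\<^sup>(\<^sup>s\<^sup>) : x\<^sup>a\<close> is the intersection of
  the \<open>P\<^sub>C\<close> over the "light" covers, those with \<open>a(C) < s\<close> (\<open>radical_colon_symbolic_power\<close>).
  Hence the set of associated radicals is determined by the nonempty families of the form
  \<open>{C. a(C) < s}\<close>, and the theorem says that these families are the same for all large \<open>s\<close>.

  Suppose that \<open>F\<close> is such a family for the exponent \<open>a\<close> and the power \<open>t\<close>.  Then \<open>\<alpha> = a/t\<close> solves the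
  linear system \<open>\<alpha>(C) < 1\<close> for \<open>C \<in> F\<close>, \<open>\<alpha>(C) \<ge> 1\<close> for the other covers, \<open>\<alpha> \<ge> 0\<close>.  Treat the slack
  \<open>\<delta>\<close> in \<open>\<alpha>(C) + \<delta> \<le> 1\<close> as one more unknown and move to a vertex of the resulting polyhedron without
  decreasing \<open>\<delta>\<close>.  There \<open>\<delta>\<close> is, by Cramer's rule, a positive integer divided by a determinant whose
  rows are, up to sign, \<open>0/1\<close> vectors with at most \<open>h\<close> ones outside the slack column, where \<open>h\<close> bounds the size
  of the covers.  Hadamard's inequality then gives \<open>\<delta> \<ge> 1 / (n h\<^bsup>n/2\<^esup>)\<close>
  (\<open>exists_cover_weight_with_slack\<close>).  For \<open>s \<ge> n h\<^bsup>(n+2)/2\<^esup>\<close> this slack is worth \<open>s\<delta> \<ge> h\<close>, whereas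
  rounding \<open>s\<alpha>\<close> up to an integer vector increases its sum over a cover \<open>C\<close> by less than
  \<open>card C \<le> h\<close>.  So the rounded vector shows that \<open>F\<close> occurs for the power \<open>s\<close> too
  (\<open>light_families_persist\<close>).

  It remains to compare \<open>h\<close> with the big height.  Each minimal \<open>P\<^sub>C\<close> is an associated prime, of height
  at least \<open>card C\<close> by the obvious chain, so the big height may be taken for \<open>h\<close> once it is known to be
  finite.  This is the bound of the Krull dimension of the polynomial ring by \<open>n\<close>
  (\<open>height_le_card\<close>): a longer chain of primes would produce \<open>n + 1\<close> algebraically independent
  polynomials.
\<close>

section \<open>Hadamard's inequality and a lower bound from Cramer's rule\<close>

text \<open>
  Gram-Schmidt, one row at a time: subtracting from a row its projection onto other rows keeps the
  determinant and does not increase the length of the row.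
\<close>

lemma orthogonalize_rows:
  fixes A :: "real^'n^'n"
  assumes "finite S"
  shows "\<exists>B :: real^'n^'n. det B = det A \<and>
           (\<forall>i\<in>S. \<forall>j\<in>S. i \<noteq> j \<longrightarrow> orthogonal (row i B) (row j B)) \<and>
           (\<forall>i. norm (row i B) \<le> norm (row i A)) \<and>
           (\<forall>i. i \<notin> S \<longrightarrow> row i B = row i A)"
  using assms
proof (induction S rule: finite_induct)
  case empty
  show ?case by (rule exI[of _ A]) simp
next
  case (insert k S)
  then obtain B :: "real^'n^'n" where B: "det B = det A"
    "\<forall>i\<in>S. \<forall>j\<in>S. i \<noteq> j \<longrightarrow> orthogonal (row i B) (row j B)"
    "\<forall>i. norm (row i B) \<le> norm (row i A)" "\<forall>i. i \<notin> S \<longrightarrow> row i B = row i A"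
    by blast
  obtain y z where yz: "y \<in> span ((\<lambda>i. row i B) ` S)"
      "\<And>w. w \<in> span ((\<lambda>i. row i B) ` S) \<Longrightarrow> orthogonal z w" "row k B = y + z"
    using orthogonal_subspace_decomp_exists[of "(\<lambda>i. row i B) ` S" "row k B"] by blast
  define B' :: "real^'n^'n" where "B' = (\<chi> i. if i = k then row k B + (- y) else row i B)"
  have rows: "row i B' = (if i = k then z else row i B)" for i
    using yz(3) by (simp add: B'_def row_def vec_eq_iff)
  have "(\<lambda>i. row i B) ` S \<subseteq> {row j B |j. j \<noteq> k}"
    using insert.hyps by auto
  then have "- y \<in> vec.span {row j B |j. j \<noteq> k}"
    using yz(1) span_mono span_neg unfolding span_vec_eq by blast
  then have "det B' = det B"
    unfolding B'_def by (rule det_row_span)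
  moreover have "norm z \<le> norm (row k B)"
  proof -
    have "orthogonal y z"
      using yz(1,2) orthogonal_commute by blast
    then have "(norm (row k B))\<^sup>2 = (norm y)\<^sup>2 + (norm z)\<^sup>2"
      unfolding yz(3) by (rule norm_add_Pythagorean)
    then have "(norm z)\<^sup>2 \<le> (norm (row k B))\<^sup>2" by simp
    then show ?thesis by (rule power2_le_imp_le) simp
  qed
  moreover have "orthogonal z (row i B)" if "i \<in> S" for i
    using that yz(2) by (simp add: span_base)
  ultimately show ?case
    using B insert.hyps
    by (intro exI[of _ B']) (auto simp: rows orthogonal_commute intro: order_trans)
qed

text \<open>
  For a matrix \<open>B\<close> with orthogonal rows, \<open>B B\<^sup>T\<close> is diagonal with the squared row lengths as entries,
  and equality holds; the general case reduces to this one by orthogonalization.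
\<close>

lemma hadamard_inequality:
  fixes A :: "real^'n^'n"
  shows "\<bar>det A\<bar> \<le> (\<Prod>i\<in>UNIV. norm (row i A))"
proof -
  obtain B :: "real^'n^'n" where B: "det B = det A"
    "\<And>i j. i \<noteq> j \<Longrightarrow> orthogonal (row i B) (row j B)"
    "\<And>i. norm (row i B) \<le> norm (row i A)"
    using orthogonalize_rows[of UNIV A] by auto
  have entry: "(B ** transpose B) $ i $ j = row i B \<bullet> row j B" for i j
    by (simp add: matrix_matrix_mult_def transpose_def row_def inner_vec_def)
  have "(det B)\<^sup>2 = det (B ** transpose B)"
    by (simp add: det_mul power2_eq_square)
  also have "\<dots> = (\<Prod>i\<in>UNIV. (B ** transpose B) $ i $ i)"
    by (rule det_diagonal) (use B(2) in \<open>simp add: entry orthogonal_def\<close>)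
  also have "\<dots> = (\<Prod>i\<in>UNIV. norm (row i B))\<^sup>2"
    by (simp add: entry prod_power_distrib power2_norm_eq_inner)
  finally have "\<bar>det B\<bar> = (\<Prod>i\<in>UNIV. norm (row i B))"
    by (metis abs_of_nonneg power2_abs power2_eq_iff_nonneg abs_ge_zero norm_ge_zero prod_nonneg)
  also have "\<dots> \<le> (\<Prod>i\<in>UNIV. norm (row i A))"
    by (rule prod_mono) (use B(3) in auto)
  finally show ?thesis by (simp add: B(1))
qed

text \<open>
  Laplace expansion along column \<open>k\<close>, with Hadamard's inequality applied to each minor.  The vectors
  \<open>a i\<close> are the rows with the entry in column \<open>k\<close> erased, so the bound does not see that column
  except through the coefficients of the expansion.
\<close>

lemma det_column_expansion_bound:
  fixes A :: "real^'n^'n" and k :: 'n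
  defines "a \<equiv> \<lambda>i. (\<chi> c. if c = k then 0 else A $ i $ c) :: real^'n"
  shows "\<bar>det A\<bar> \<le> (\<Sum>i\<in>UNIV. \<bar>A $ i $ k\<bar> * (\<Prod>j\<in>UNIV - {i}. norm (a j)))"
proof -
  define M where "M i = (\<chi> r c. if c = k then (if r = i then 1 else 0) else A $ r $ c :: real^'n^'n)" for i
  define N where "N i = (\<chi> r. if r = i then axis k 1 else a r :: real^'n^'n)" for i
  have "transpose A = (\<chi> r. if r = k then (\<Sum>i\<in>UNIV. A $ i $ k *s axis i 1) else transpose A $ r)"
    by (simp add: vec_eq_iff transpose_def axis_def if_distrib cong: if_cong)
  then have "det A = det (\<chi> r. if r = k then (\<Sum>i\<in>UNIV. A $ i $ k *s axis i 1) else transpose A $ r)"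
    by (metis det_transpose)
  also have "\<dots> = (\<Sum>i\<in>UNIV. det (\<chi> r. if r = k then A $ i $ k *s axis i 1 else transpose A $ r))"
    by (rule det_linear_row_sum) simp
  also have "\<dots> = (\<Sum>i\<in>UNIV. A $ i $ k * det (M i))"
  proof (rule sum.cong[OF refl])
    fix i :: 'n
    have "(\<chi> r. if r = k then axis i 1 else transpose A $ r) = transpose (M i)"
      by (auto simp add: vec_eq_iff transpose_def axis_def M_def)
    then show "det (\<chi> r. if r = k then A $ i $ k *s axis i 1 else transpose A $ r) = A $ i $ k * det (M i)"
      by (simp add: det_row_mul)
  qed
  finally have det_A: "det A = (\<Sum>i\<in>UNIV. A $ i $ k * det (M i))" .
  have bound: "\<bar>det (M i)\<bar> \<le> (\<Prod>j\<in>UNIV - {i}. norm (a j))" for i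
  proof -
    \<comment> \<open>Splitting off the entry in column \<open>k\<close> from row \<open>i\<close> leaves a matrix with zero column \<open>k\<close>.\<close>
    have "M i = (\<chi> r. if r = i then a i + axis k 1 else a r)"
      by (auto simp: M_def a_def vec_eq_iff axis_def)
    then have "det (M i) = det (\<chi> r. if r = i then a i else a r) + det (N i)"
      unfolding N_def by (simp only: det_row_add)
    also have "det (\<chi> r. if r = i then a i else a r) = 0"
      by (rule det_zero_column[of k]) (simp add: column_def a_def vec_eq_iff)
    finally have "\<bar>det (M i)\<bar> \<le> (\<Prod>j\<in>UNIV. norm (row j (N i)))"
      using hadamard_inequality[of "N i"] by simp
    also have "\<dots> = norm (row i (N i)) * (\<Prod>j\<in>UNIV - {i}. norm (row j (N i)))"
      by (rule prod.remove) auto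
    also have "row i (N i) = axis k 1"
      by (simp add: row_def N_def vec_eq_iff)
    also have "(\<Prod>j\<in>UNIV - {i}. norm (row j (N i))) = (\<Prod>j\<in>UNIV - {i}. norm (a j))"
      by (rule prod.cong) (auto simp: row_def N_def vec_eq_iff intro!: arg_cong[of _ _ norm])
    finally show ?thesis by simp
  qed
  have "\<bar>det A\<bar> \<le> (\<Sum>i\<in>UNIV. \<bar>A $ i $ k * det (M i)\<bar>)"
    unfolding det_A by (rule sum_abs)
  also have "\<dots> \<le> (\<Sum>i\<in>UNIV. \<bar>A $ i $ k\<bar> * (\<Prod>j\<in>UNIV - {i}. norm (a j)))"
    by (rule sum_mono) (auto simp: abs_mult intro!: mult_left_mono bound)
  finally show ?thesis .
qed

lemma det_in_Ints:
  fixes A :: "real^'n^'n"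
  assumes "\<And>i j. A $ i $ j \<in> \<int>"
  shows "det A \<in> \<int>"
  unfolding det_def by (intro Ints_sum Ints_mult Ints_prod assms) auto

text \<open>
  By Cramer's rule the coordinate \<open>z $ k\<close> is an integer divided by \<open>det M\<close>, so a bound on the determinant
  keeps a positive coordinate away from \<open>0\<close>.  The factor is \<open>n\<close>, although column \<open>k\<close> has \<open>n + 1\<close>
  entries: if all of them are \<open>1\<close>, then the unique solution is the \<open>k\<close>-th unit vector, and otherwise
  at most \<open>n\<close> terms of the expansion survive.
\<close>

lemma coordinate_lower_bound:
  fixes M :: "real^'m^'m" and z b :: "real^'m" and k :: 'm and h :: real and n :: nat
  defines "a \<equiv> \<lambda>i. (\<chi> c. if c = k then 0 else M $ i $ c) :: real^'m"
  assumes n: "CARD('m) = Suc n" "n \<ge> 1" and h: "h \<ge> 1"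
    and det: "det M \<noteq> 0" and sol: "M *v z = b"
    and ints: "\<And>i j. M $ i $ j \<in> \<int>" "\<And>i. b $ i \<in> \<int>"
    and col: "\<And>i. M $ i $ k \<in> {0, 1}" "\<And>i. M $ i $ k = 1 \<Longrightarrow> b $ i = 1"
    and norms: "\<And>i. norm (a i) \<le> h"
    and pos: "z $ k > 0"
  shows "1 \<le> z $ k * (real n * h ^ n)"
proof (cases "\<forall>i. M $ i $ k = 1")
  case True
  then have "M *v axis k 1 = b"
    using col(2) by (simp add: vec_eq_iff matrix_vector_mult_def axis_def if_distrib cong: if_cong)
  then have "z = axis k 1"
    using cramer[OF det, of z b] cramer[OF det, of "axis k 1" b] sol by simp
  then have "z $ k = 1" by simp
  moreover have "1 \<le> real n * h ^ n"
    using n(2) h mult_mono[of 1 "real n" 1 "h ^ n"] by simp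
  ultimately show ?thesis by simp
next
  case False
  then obtain i0 where i0: "M $ i0 $ k = 0" using col(1) by auto
  have card: "card (UNIV - {i}) = n" for i :: 'm
    using n(1) by (simp add: card_Diff_singleton)
  have "\<bar>det M\<bar> \<le> (\<Sum>i\<in>UNIV. \<bar>M $ i $ k\<bar> * (\<Prod>j\<in>UNIV - {i}. norm (a j)))"
    unfolding a_def by (rule det_column_expansion_bound)
  also have "\<dots> \<le> (\<Sum>i\<in>UNIV. if i = i0 then 0 else h ^ n)"
  proof (rule sum_mono)
    fix i :: 'm
    have "(\<Prod>j\<in>UNIV - {i}. norm (a j)) \<le> (\<Prod>j\<in>UNIV - {i}. h)"
      by (rule prod_mono) (auto simp: norms)
    then have "(\<Prod>j\<in>UNIV - {i}. norm (a j)) \<le> h ^ n" by (simp add: card del: Diff_iff)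
    then show "\<bar>M $ i $ k\<bar> * (\<Prod>j\<in>UNIV - {i}. norm (a j)) \<le> (if i = i0 then 0 else h ^ n)"
      using col(1)[of i] i0 h by auto
  qed
  also have "\<dots> = (\<Sum>i\<in>UNIV - {i0}. h ^ n)"
    by (rule sum.mono_neutral_cong_right) auto
  also have "\<dots> = real n * h ^ n" by (simp only: sum_constant card)
  finally have det_le: "\<bar>det M\<bar> \<le> real n * h ^ n" .
  define D where "D = det (\<chi> i j. if j = k then b $ i else M $ i $ j)"
  have "D = z $ k * det M"
    unfolding D_def sol[symmetric] by (rule cramer_lemma)
  moreover have "D \<in> \<int>"
    unfolding D_def by (rule det_in_Ints) (simp add: ints)
  ultimately have "1 \<le> \<bar>z $ k * det M\<bar>"
    using pos det by (metis Ints_nonzero_abs_ge1 mult_eq_0_iff less_irrefl)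
  also have "\<dots> \<le> z $ k * (real n * h ^ n)"
    using pos det_le by (simp add: abs_mult)
  finally show ?thesis .
qed

section \<open>Vertices of polyhedra\<close>

text \<open>
  Each pair \<open>(r, b)\<close> stands for the constraint \<open>r \<bullet> z \<le> b\<close>.  As long as the tight constraints do not span
  the space, there is a direction orthogonal to all of them in which \<open>c\<close> does not decrease.  Moving in this
  direction keeps the tight constraints tight, and by the hypothesis \<open>bounded\<close> it must hit a new one.
  So a feasible point at least as good as \<open>z0\<close> with the largest number of tight constraints is a vertex.
\<close>

lemma exists_vertex_improving:
  fixes A :: "('a::euclidean_space \<times> real) set" and c z0 :: 'a
  assumes "finite A"
    and feas: "\<And>r b. (r, b) \<in> A \<Longrightarrow> r \<bullet> z0 \<le> b"
    and bounded: "\<And>d. d \<noteq> 0 \<Longrightarrow> c \<bullet> d \<ge> 0 \<Longrightarrow> \<exists>(r, b)\<in>A. r \<bullet> d > 0"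
  obtains z where "\<And>r b. (r, b) \<in> A \<Longrightarrow> r \<bullet> z \<le> b" "c \<bullet> z0 \<le> c \<bullet> z"
    "span {r. (r, r \<bullet> z) \<in> A} = UNIV"
proof -
  define T where "T z = {p\<in>A. fst p \<bullet> z = snd p}" for z
  define P where "P z \<longleftrightarrow> (\<forall>(r, b)\<in>A. r \<bullet> z \<le> b) \<and> c \<bullet> z0 \<le> c \<bullet> z" for z
  have T_sub: "T z \<subseteq> A" for z by (auto simp: T_def)
  have finT: "finite (T z)" for z
    using T_sub \<open>finite A\<close> finite_subset by blast
  have "P z0" using feas by (auto simp: P_def)
  moreover have "\<forall>z. P z \<longrightarrow> card (T z) < Suc (card A)"
    using T_sub \<open>finite A\<close> by (simp add: card_mono less_Suc_eq_le)
  ultimately obtain z where z: "P z" "\<And>y. P y \<Longrightarrow> card (T y) \<le> card (T z)"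
    using ex_has_greatest_nat[of P z0 "\<lambda>z. card (T z)" "Suc (card A)"] by blast
  have "span {r. (r, r \<bullet> z) \<in> A} = UNIV"
  proof (rule ccontr)
    assume "span {r. (r, r \<bullet> z) \<in> A} \<noteq> UNIV"
    then obtain d0 where d0: "d0 \<noteq> 0" "\<forall>x\<in>span {r. (r, r \<bullet> z) \<in> A}. d0 \<bullet> x = 0"
      using span_not_UNIV_orthogonal by blast
    \<comment> \<open>One of the two opposite directions does not decrease \<open>c\<close>.\<close>
    define d where "d = (if c \<bullet> d0 \<ge> 0 then d0 else - d0)"
    have d: "d \<noteq> 0" "c \<bullet> d \<ge> 0"
      using d0(1) by (auto simp: d_def)
    have d_orth: "r \<bullet> d = 0" if "(r, r \<bullet> z) \<in> A" for r
    proof -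
      have "r \<in> span {r. (r, r \<bullet> z) \<in> A}" using that by (simp add: span_base)
      then show ?thesis using d0(2) by (auto simp: d_def inner_commute)
    qed
    define B where "B = {p\<in>A. fst p \<bullet> d > 0}"
    define q where "q p = (snd p - fst p \<bullet> z) / (fst p \<bullet> d)" for p
    have B: "finite B" "B \<noteq> {}"
      using bounded[OF d] \<open>finite A\<close> by (auto simp: B_def)
    \<comment> \<open>the largest step that remains feasible\<close>
    define t where "t = Min (q ` B)"
    obtain p where p: "p \<in> B" "t = q p"
      using B Min_in[of "q ` B"] unfolding t_def by blast
    have q_nonneg: "q p \<ge> 0" if "p \<in> B" for p
      using that z(1) by (auto simp: q_def B_def P_def)
    have t0: "t \<ge> 0" using p q_nonneg by simp
    have "P (z + t *\<^sub>R d)"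
      unfolding P_def
    proof (intro conjI ballI, clarify)
      fix r b assume rb: "(r, b) \<in> A"
      show "r \<bullet> (z + t *\<^sub>R d) \<le> b"
      proof (cases "r \<bullet> d > 0")
        case True
        then have "(r, b) \<in> B" using rb by (simp add: B_def)
        then have "t \<le> q (r, b)" using B(1) by (simp add: t_def)
        then have "t * (r \<bullet> d) \<le> b - r \<bullet> z"
          using True by (simp add: q_def pos_le_divide_eq)
        then show ?thesis by (simp add: inner_add_right)
      next
        case False
        then have "t * (r \<bullet> d) \<le> 0" using t0 by (simp add: mult_nonneg_nonpos)
        moreover have "r \<bullet> z \<le> b" using rb z(1) by (auto simp: P_def)
        ultimately show ?thesis by (simp add: inner_add_right)
      qed
    next
      show "c \<bullet> z0 \<le> c \<bullet> (z + t *\<^sub>R d)"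
        using z(1) d(2) t0 by (simp add: P_def inner_add_right add_increasing2)
    qed
    then have "card (T (z + t *\<^sub>R d)) \<le> card (T z)" by (rule z(2))
    moreover have "T z \<subset> T (z + t *\<^sub>R d)"
    proof
      show "T z \<subseteq> T (z + t *\<^sub>R d)"
        using d_orth by (auto simp: T_def inner_add_right)
      have "p \<in> T (z + t *\<^sub>R d)"
        using p by (simp add: T_def B_def q_def inner_add_right)
      moreover have "p \<notin> T z"
        using p(1) d_orth[of "fst p"] by (auto simp: T_def B_def)
      ultimately show "T z \<noteq> T (z + t *\<^sub>R d)" by blast
    qed
    ultimately show False
      using psubset_card_mono[OF finT] by (metis not_less)
  qed
  then show ?thesis
    using that[of z] z(1) unfolding P_def by blast
qed

section \<open>Weights on covers with a large slack\<close>

lemma inner_option_vector: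
  fixes v w :: "real^('x::finite option)"
  shows "v \<bullet> w = v $ None * w $ None + (\<Sum>x\<in>UNIV. v $ Some x * w $ Some x)"
proof -
  have "v \<bullet> w = (\<Sum>i\<in>insert None (range Some). v $ i * w $ i)"
    by (simp add: inner_vec_def UNIV_option_conv)
  then show ?thesis
    by (simp add: sum.reindex)
qed

text \<open>
  The coordinates of the linear programme are the weights \<open>Some x\<close> and the slack \<open>None\<close>.  This is the
  coefficient vector of the sum over \<open>C\<close> plus \<open>e\<close> times the slack.
\<close>

definition incidence_row :: "'x::finite set \<Rightarrow> real \<Rightarrow> real^('x option)" where
  "incidence_row C e = (\<chi> i. case i of None \<Rightarrow> e | Some x \<Rightarrow> of_bool (x \<in> C))"

lemma inner_incidence_row:
  "incidence_row C e \<bullet> z = e * z $ None + (\<Sum>x\<in>C. z $ Some x)"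
proof -
  have "(\<Sum>x\<in>UNIV. of_bool (x \<in> C) * z $ Some x) = (\<Sum>x\<in>C. z $ Some x)"
    by (rule sum.mono_neutral_cong_right) auto
  then show ?thesis
    by (simp add: inner_option_vector incidence_row_def)
qed

lemma norm_incidence_row: "norm (incidence_row C 0) = sqrt (card C)"
  by (simp add: norm_eq_sqrt_inner inner_incidence_row) (simp add: incidence_row_def)

text \<open>
  The set \<open>F\<close> of covers that some nonnegative real weight makes light can be made light with a slack
  that depends only on the number of variables and the size of the covers.  The given weight, truncated
  at \<open>1\<close>, is a feasible point with positive slack; a vertex of the programme with at least this slack is
  determined by tight constraints with coefficients \<open>0\<close> and \<open>\<plusminus>1\<close>, to which the determinant bound applies.
  Truncation keeps the other covers heavy, since a single truncated element already has weight \<open>1\<close>, and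
  it makes the programme bounded.
\<close>

lemma exists_cover_weight_with_slack:
  fixes \<C> F :: "'x::finite set set" and \<alpha> :: "'x \<Rightarrow> real" and h :: nat
  assumes F: "F \<subseteq> \<C>" "F \<noteq> {}"
    and size: "\<And>C. C \<in> \<C> \<Longrightarrow> C \<noteq> {} \<and> card C \<le> h"
    and nonneg: "\<And>x. 0 \<le> \<alpha> x"
    and light: "\<And>C. C \<in> F \<Longrightarrow> sum \<alpha> C < 1"
    and heavy: "\<And>C. C \<in> \<C> - F \<Longrightarrow> 1 \<le> sum \<alpha> C"
  obtains \<beta> :: "'x \<Rightarrow> real" and \<delta> :: real where
    "\<And>x. 0 \<le> \<beta> x" "1 \<le> \<delta> * (CARD('x) * sqrt h ^ CARD('x))"
    "\<And>C. C \<in> F \<Longrightarrow> sum \<beta> C + \<delta> \<le> 1" "\<And>C. C \<in> \<C> - F \<Longrightarrow> 1 \<le> sum \<beta> C"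
proof -
  have fin: "finite \<C>" "finite F" by simp_all
  obtain C0 where C0: "C0 \<in> F" using F(2) by blast
  have h1: "h \<ge> 1"
  proof -
    have "card C0 \<ge> 1" using size[of C0] C0 F(1) by (simp add: Suc_leI card_gt_0_iff subsetD)
    then show ?thesis using size[of C0] C0 F(1) by (meson le_trans subsetD)
  qed
  \<comment> \<open>Bounding each weight on both sides leaves the slack as the only unbounded direction, and light covers bound it above.\<close>
  define A :: "((real^('x option)) \<times> real) set" where "A = (\<lambda>C. (incidence_row C 1, 1)) ` F \<union>
      (\<lambda>C. (- incidence_row C 0, - 1)) ` (\<C> - F) \<union>
      range (\<lambda>x. (- incidence_row {x} 0, 0)) \<union> range (\<lambda>x. (incidence_row {x} 0, 1))"
  have "finite A" unfolding A_def by simp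
  have A_cases: "(\<exists>C\<in>F. r = incidence_row C 1 \<and> b = 1) \<or>
      (\<exists>C\<in>\<C> - F. r = - incidence_row C 0 \<and> b = - 1) \<or>
      (\<exists>x. r = - incidence_row {x} 0 \<and> b = 0) \<or> (\<exists>x. r = incidence_row {x} 0 \<and> b = 1)"
    if "(r, b) \<in> A" for r b
    using that unfolding A_def by blast
  define \<delta>0 where "\<delta>0 = Min ((\<lambda>C. 1 - sum \<alpha> C) ` F)"
  have \<delta>0: "\<delta>0 > 0" "\<And>C. C \<in> F \<Longrightarrow> \<delta>0 \<le> 1 - sum \<alpha> C"
    unfolding \<delta>0_def using F(2) fin light by simp_all
  define z0 :: "real^('x option)"
    where "z0 = (\<chi> i. case i of None \<Rightarrow> \<delta>0 | Some x \<Rightarrow> min 1 (\<alpha> x))"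
  have feas: "r \<bullet> z0 \<le> b" if "(r, b) \<in> A" for r and b :: real
  proof -
    have le: "(\<Sum>x\<in>C. min 1 (\<alpha> x)) \<le> sum \<alpha> C" for C
      by (rule sum_mono) simp
    have ge: "1 \<le> (\<Sum>x\<in>C. min 1 (\<alpha> x))" if "C \<in> \<C> - F" for C
    proof (cases "\<exists>x\<in>C. \<alpha> x > 1")
      case True
      then obtain x where "x \<in> C" "\<alpha> x > 1" by blast
      then have "1 = min 1 (\<alpha> x)" by simp
      also have "\<dots> \<le> (\<Sum>x\<in>C. min 1 (\<alpha> x))"
        by (rule member_le_sum[OF \<open>x \<in> C\<close>]) (simp_all add: nonneg)
      finally show ?thesis .
    next
      case False
      then have "(\<Sum>x\<in>C. min 1 (\<alpha> x)) = sum \<alpha> C"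
        by (intro sum.cong) (auto simp: min_def not_less)
      then show ?thesis using heavy[OF that] by simp
    qed
    have "\<delta>0 + (\<Sum>x\<in>C. min 1 (\<alpha> x)) \<le> 1" if "C \<in> F" for C
      using le[of C] \<delta>0(2)[OF that] by linarith
    then show ?thesis
      using A_cases[OF that] nonneg ge by (auto simp: inner_incidence_row z0_def)
  qed
  have bounded: "\<exists>(r, b)\<in>A. r \<bullet> d > 0"
    if d: "d \<noteq> 0" "axis None 1 \<bullet> d \<ge> 0" for d :: "real^('x option)"
  proof (cases "\<exists>x. d $ Some x \<noteq> 0")
    case True
    then obtain x where x: "d $ Some x \<noteq> 0" by blast
    define p :: "(real^('x option)) \<times> real" where
      "p = (if d $ Some x > 0 then (incidence_row {x} 0, 1) else (- incidence_row {x} 0, 0))"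
    have "p \<in> A" unfolding p_def A_def by auto
    then show ?thesis
      using x by (intro bexI[of _ p]) (simp_all add: p_def inner_incidence_row)
  next
    case False
    then have 0: "d $ Some x = 0" for x by simp
    have "d $ None \<noteq> 0"
    proof
      assume "d $ None = 0"
      then have "d $ i = 0" for i using 0 by (cases i) auto
      then show False using d(1) by (simp add: vec_eq_iff)
    qed
    then have "d $ None > 0" using d(2) by (simp add: inner_axis')
    moreover have "(incidence_row C0 1, 1) \<in> A"
      using C0 unfolding A_def by blast
    ultimately show ?thesis
      using 0 by (intro bexI[of _ "(incidence_row C0 1, 1)"]) (simp_all add: inner_incidence_row)
  qed
  obtain z where z: "\<And>r b. (r, b) \<in> A \<Longrightarrow> r \<bullet> z \<le> b" "axis None 1 \<bullet> z0 \<le> axis None 1 \<bullet> z"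
      and spans: "span {r. (r, r \<bullet> z) \<in> A} = UNIV"
    using exists_vertex_improving[OF \<open>finite A\<close> feas bounded] by blast
  have pos: "z $ None > 0"
    using z(2) \<delta>0(1) by (simp add: inner_axis' z0_def)
  obtain B where B: "B \<subseteq> {r. (r, r \<bullet> z) \<in> A}" "independent B"
      and "{r. (r, r \<bullet> z) \<in> A} \<subseteq> span B"
    using maximal_independent_subset by blast
  then have spanB: "span B = UNIV"
    using span_minimal[of _ "span B"] spans by (metis subspace_span top.extremum_uniqueI)
  have "finite B" using B(2) by (rule independent_imp_finite)
  have "card B = CARD('x option)"
    using dim_span[of B] dim_eq_card_independent[OF B(2)] spanB by simp
  then obtain f where f: "bij_betw f (UNIV :: 'x option set) B"
    using \<open>finite B\<close> finite_same_card_bij[of "UNIV :: 'x option set" B] by auto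
  define M :: "real^('x option)^('x option)" where "M = (\<chi> i. f i)"
  have row_M: "row i M = f i" for i by (simp add: row_def M_def vec_eq_iff)
  have "rows M = B"
    using f by (auto simp: rows_def row_M bij_betw_def)
  then have det: "det M \<noteq> 0"
    using spanB matrix_left_invertible_span_rows[of M] invertible_det_nz[of M]
    by (metis invertible_def matrix_left_right_inverse)
  have fA: "(f i, f i \<bullet> z) \<in> A" for i
    using f B(1) by (auto simp: bij_betw_def)
  define b where "b = M *v z"
  have b: "b $ i = f i \<bullet> z" for i
    by (simp add: b_def M_def matrix_vector_mult_def inner_vec_def)
  have row_bound: "norm ((\<chi> c. if c = None then 0 else M $ i $ c) :: real^('x option)) \<le> sqrt h" for i
  proof -
    \<comment> \<open>The constraints \<open>0 \<le> z $ Some x \<le> 1\<close> have the rows of the singletons, so every row has this shape.\<close>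
    have shape: "\<exists>C e. (f i = incidence_row C e \<or> f i = - incidence_row C e) \<and> card C \<le> h"
      using A_cases[OF fA[of i]] size F(1) h1 by (elim disjE) (fastforce simp: subset_iff)+
    then obtain C e where "f i = incidence_row C e \<or> f i = - incidence_row C e" and C: "card C \<le> h"
      by blast
    then have "(\<chi> c. if c = None then 0 else M $ i $ c) = incidence_row C 0 \<or>
        (\<chi> c. if c = None then 0 else M $ i $ c) = - incidence_row C 0"
      by (auto simp: vec_eq_iff M_def incidence_row_def split: option.splits)
    then have "norm ((\<chi> c. if c = None then 0 else M $ i $ c) :: real^('x option)) = sqrt (card C)"
      by (elim disjE) (simp_all add: norm_incidence_row)
    then show ?thesis using C by simp
  qed
  have "1 \<le> z $ None * (CARD('x) * sqrt h ^ CARD('x))"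
  proof (rule coordinate_lower_bound[where M = M and b = b])
    show "CARD('x option) = Suc CARD('x)" by (simp add: card_UNIV_option)
    show "1 \<le> CARD('x)" by (simp add: Suc_leI)
    show "1 \<le> sqrt h" using h1 by simp
    show "M $ i $ j \<in> \<int>" for i j
      using A_cases[OF fA[of i]]
      by (elim disjE) (auto simp: M_def incidence_row_def split: option.splits)
    show "b $ i \<in> \<int>" for i
      using A_cases[OF fA[of i]] unfolding b by (elim disjE) auto
    show "M $ i $ None \<in> {0, 1}" for i
      using A_cases[OF fA[of i]] by (elim disjE) (auto simp: M_def incidence_row_def)
    show "M $ i $ None = 1 \<Longrightarrow> b $ i = 1" for i
      using A_cases[OF fA[of i]] unfolding b M_def
      by (elim disjE) (auto simp: incidence_row_def)
  qed (use det b_def row_bound pos in auto)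
  moreover have "0 \<le> z $ Some x" for x
    using z(1)[of "- incidence_row {x} 0" 0] unfolding A_def by (simp add: inner_incidence_row)
  moreover have "(\<Sum>x\<in>C. z $ Some x) + z $ None \<le> 1" if "C \<in> F" for C
    using z(1)[of "incidence_row C 1" 1] that unfolding A_def by (simp add: inner_incidence_row)
  moreover have "1 \<le> (\<Sum>x\<in>C. z $ Some x)" if "C \<in> \<C> - F" for C
    using z(1)[of "- incidence_row C 0" "- 1"] that unfolding A_def by (simp add: inner_incidence_row)
  ultimately show ?thesis
    using that[of "\<lambda>x. z $ Some x" "z $ None"] by blast
qed

section \<open>Rounding weights to exponents\<close>

text \<open>
  Scaling the exponent \<open>a\<close> by \<open>1 / t\<close> gives a real weight, which is replaced by one with a large slack
  \<open>\<delta>\<close>, scaled by \<open>s\<close> and rounded up.  Heavy covers stay heavy.  A light cover \<open>C\<close> gains less than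
  \<open>card C \<le> h\<close>, and \<open>s\<close> is so large that \<open>h \<le> s * \<delta>\<close>.  The power \<open>t\<close> is arbitrary, so
  that two large powers can be compared in both directions.
\<close>

lemma light_families_persist:
  fixes \<C> :: "'x::finite set set" and a :: "'x \<Rightarrow> nat" and h s t :: nat
  assumes size: "\<And>C. C \<in> \<C> \<Longrightarrow> C \<noteq> {} \<and> card C \<le> h"
    and large: "real CARD('x) * real h powr ((real CARD('x) + 2) / 2) \<le> real s"
    and nonempty: "{C \<in> \<C>. sum a C < t} \<noteq> {}"
  obtains b :: "'x \<Rightarrow> nat" where "{C \<in> \<C>. sum b C < s} = {C \<in> \<C>. sum a C < t}"
proof -
  define F where "F = {C \<in> \<C>. sum a C < t}"
  define n where "n = CARD('x)"
  have F: "F \<subseteq> \<C>" "F \<noteq> {}" using nonempty by (auto simp: F_def)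
  then obtain C0 where C0: "C0 \<in> F" by blast
  then have t: "t > 0" by (auto simp: F_def)
  have h1: "h \<ge> 1"
    using size[of C0] C0 F(1) by (metis One_nat_def Suc_leI card_gt_0_iff finite le_trans subsetD)
  define \<alpha> where "\<alpha> x = real (a x) / real t" for x
  have sum\<alpha>: "sum \<alpha> C = real (sum a C) / real t" for C
    by (simp add: \<alpha>_def sum_divide_distrib)
  obtain \<beta> :: "'x \<Rightarrow> real" and \<delta> :: real where \<beta>:
    "\<And>x. 0 \<le> \<beta> x" "1 \<le> \<delta> * (n * sqrt h ^ n)"
    "\<And>C. C \<in> F \<Longrightarrow> sum \<beta> C + \<delta> \<le> 1" "\<And>C. C \<in> \<C> - F \<Longrightarrow> 1 \<le> sum \<beta> C"
  proof (rule exists_cover_weight_with_slack[of F \<C> h \<alpha>])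
    show "sum \<alpha> C < 1" if "C \<in> F" for C
      using that t unfolding sum\<alpha> by (simp add: F_def del: of_nat_sum)
    show "1 \<le> sum \<alpha> C" if "C \<in> \<C> - F" for C
      using that t unfolding sum\<alpha> by (simp add: F_def not_less del: of_nat_sum)
  qed (use F size in \<open>auto simp: \<alpha>_def n_def\<close>)
  have n1: "n \<ge> 1" by (simp add: n_def Suc_leI)
  have "\<delta> > 0"
  proof (rule ccontr)
    assume "\<not> \<delta> > 0"
    then have "\<delta> * (n * sqrt h ^ n) \<le> 0" by (simp add: mult_nonpos_nonneg)
    then show False using \<beta>(2) by linarith
  qed
  have "real h powr ((real n + 2) / 2) = sqrt h ^ n * h"
  proof -
    have "(real n + 2) / 2 = 1 / 2 * real n + 1" by simp
    then have "real h powr ((real n + 2) / 2) = (real h powr (1 / 2)) powr real n * real h powr 1"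
      by (simp only: powr_powr powr_add)
    then show ?thesis
      using h1 by (simp add: powr_half_sqrt powr_realpow)
  qed
  then have "real n * (sqrt h ^ n * h) \<le> s"
    using large by (simp add: n_def)
  then have "\<delta> * (n * (sqrt h ^ n * h)) \<le> \<delta> * s"
    using \<open>\<delta> > 0\<close> by (intro mult_left_mono) auto
  moreover have "1 * real h \<le> (\<delta> * (n * sqrt h ^ n)) * h"
    using \<beta>(2) by (intro mult_right_mono) auto
  ultimately have slack: "real h \<le> \<delta> * s" by (simp add: mult.assoc)
  define b where "b x = nat \<lceil>s * \<beta> x\<rceil>" for x
  have b_ge: "s * \<beta> x \<le> b x" and b_less: "b x < s * \<beta> x + 1" for x
    using \<beta>(1)[of x] unfolding b_def by (simp_all add: of_nat_nat) linarith+
  have "sum b C < s \<longleftrightarrow> sum a C < t" if "C \<in> \<C>" for C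
  proof (cases "C \<in> F")
    case True
    have "real (sum b C) < (\<Sum>x\<in>C. s * \<beta> x + 1)"
      unfolding of_nat_sum using size[OF that] by (intro sum_strict_mono b_less) auto
    also have "\<dots> = s * sum \<beta> C + card C"
      by (simp add: sum.distrib sum_distrib_left)
    also have "\<dots> \<le> s * (1 - \<delta>) + h"
      using \<beta>(3)[OF True] size[OF that] by (intro add_mono mult_left_mono) auto
    also have "\<dots> \<le> s" using slack by (simp add: algebra_simps)
    finally show ?thesis using True by (simp add: F_def del: of_nat_sum)
  next
    case False
    have "real s \<le> s * sum \<beta> C"
      using \<beta>(4)[of C] False that mult_left_mono[of 1 "sum \<beta> C" "real s"] by simp
    also have "\<dots> \<le> real (sum b C)"
      unfolding of_nat_sum sum_distrib_left by (intro sum_mono b_ge)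
    finally show ?thesis using False that by (simp add: F_def del: of_nat_sum)
  qed
  then show ?thesis using that[of b] by (auto simp: F_def)
qed

section \<open>Ideals of a commutative ring type\<close>

lemma ideal_ring_of_iff:
  fixes J :: "'a::comm_ring_1 set"
  shows "ideal J (ring_of TYPE('a)) \<longleftrightarrow>
    0 \<in> J \<and> (\<forall>a\<in>J. \<forall>b\<in>J. a + b \<in> J) \<and> (\<forall>a\<in>J. \<forall>r. r * a \<in> J)"
proof
  assume "ideal J (ring_of TYPE('a))"
  then interpret ideal J "ring_of TYPE('a)" .
  show "0 \<in> J \<and> (\<forall>a\<in>J. \<forall>b\<in>J. a + b \<in> J) \<and> (\<forall>a\<in>J. \<forall>r. r * a \<in> J)"
    using additive_subgroup.zero_closed[OF additive_subgroup_axioms]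
      additive_subgroup.a_closed[OF additive_subgroup_axioms] I_l_closed
    by (simp add: ring_of_type_algebra_def)
next
  assume J: "0 \<in> J \<and> (\<forall>a\<in>J. \<forall>b\<in>J. a + b \<in> J) \<and> (\<forall>a\<in>J. \<forall>r. r * a \<in> J)"
  interpret ring "ring_of TYPE('a)" by (rule ring_from_type_algebra)
  have neg: "- a \<in> J" if "a \<in> J" for a
    using J that by (metis mult_minus1)
  have inv: "\<exists>b\<in>J. b + a = 0" if "a \<in> J" for a
    using neg[OF that] by (intro bexI[of _ "- a"]) auto
  show "ideal J (ring_of TYPE('a))"
  proof (rule idealI)
    show "subgroup J (add_monoid (ring_of TYPE('a)))"
    proof (rule add.subgroupI)
      fix a assume "a \<in> J"
      have "\<ominus>\<^bsub>ring_of TYPE('a)\<^esub> a = - a"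
        by (rule minus_equality) (simp_all add: ring_of_type_algebra_def)
      then show "\<ominus>\<^bsub>ring_of TYPE('a)\<^esub> a \<in> J"
        using neg[OF \<open>a \<in> J\<close>] by simp
    qed (use J in \<open>auto simp: ring_of_type_algebra_def\<close>)
  qed (use J in \<open>auto simp: ring_of_type_algebra_def ring_axioms mult.commute intro: ring_from_type_algebra[unfolded ring_of_type_algebra_def]\<close>)
qed

lemma primeideal_ring_of_iff:
  fixes J :: "'a::comm_ring_1 set"
  shows "primeideal J (ring_of TYPE('a)) \<longleftrightarrow>
    ideal J (ring_of TYPE('a)) \<and> 1 \<notin> J \<and> (\<forall>a b. a * b \<in> J \<longrightarrow> a \<in> J \<or> b \<in> J)"
proof
  assume "primeideal J (ring_of TYPE('a))"
  then interpret primeideal J "ring_of TYPE('a)" .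
  have "1 \<notin> J"
    using I_notcarr one_imp_carrier by (auto simp: ring_of_type_algebra_def)
  then show "ideal J (ring_of TYPE('a)) \<and> 1 \<notin> J \<and> (\<forall>a b. a * b \<in> J \<longrightarrow> a \<in> J \<or> b \<in> J)"
    using ideal_axioms I_prime by (simp add: ring_of_type_algebra_def)
next
  assume "ideal J (ring_of TYPE('a)) \<and> 1 \<notin> J \<and> (\<forall>a b. a * b \<in> J \<longrightarrow> a \<in> J \<or> b \<in> J)"
  then show "primeideal J (ring_of TYPE('a))"
    by (intro primeidealI cring_from_type_algebra) (auto simp: ring_of_type_algebra_def)
qed

lemmas idealD = ideal_ring_of_iff[THEN iffD1]

lemma ideal_sum_mem:
  fixes J :: "'a::comm_ring_1 set"
  assumes "ideal J (ring_of TYPE('a))" "\<And>x. x \<in> S \<Longrightarrow> f x \<in> J"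
  shows "sum f S \<in> J"
  using assms(2) idealD[OF assms(1)] by (induction S rule: infinite_finite_induct) auto

lemma prime_power_mem:
  fixes p :: "'a::comm_ring_1 set"
  assumes "primeideal p (ring_of TYPE('a))" "g ^ m \<in> p"
  shows "g \<in> p"
  using assms(2) by (induction m) (use assms(1) in \<open>auto simp: primeideal_ring_of_iff\<close>)

lemma prime_prod_mem:
  fixes p :: "'a::comm_ring_1 set"
  assumes "primeideal p (ring_of TYPE('a))" "prod f S \<in> p"
  shows "\<exists>x\<in>S. f x \<in> p"
  using assms(2)
  by (induction S rule: infinite_finite_induct) (use assms(1) in \<open>auto simp: primeideal_ring_of_iff\<close>)

lemma mem_genideal_ring_of:
  fixes S :: "'a::comm_ring_1 set"
  shows "S \<subseteq> Idl\<^bsub>ring_of TYPE('a)\<^esub> S" "ideal (Idl\<^bsub>ring_of TYPE('a)\<^esub> S) (ring_of TYPE('a))"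
    "ideal J (ring_of TYPE('a)) \<Longrightarrow> S \<subseteq> J \<Longrightarrow> Idl\<^bsub>ring_of TYPE('a)\<^esub> S \<subseteq> J"
proof -
  interpret ring "ring_of TYPE('a)" by (rule ring_from_type_algebra)
  show "S \<subseteq> Idl\<^bsub>ring_of TYPE('a)\<^esub> S" "ideal (Idl\<^bsub>ring_of TYPE('a)\<^esub> S) (ring_of TYPE('a))"
    using genideal_self[of S] genideal_ideal[of S] by (simp_all add: ring_of_type_algebra_def)
  show "ideal J (ring_of TYPE('a)) \<Longrightarrow> S \<subseteq> J \<Longrightarrow> Idl\<^bsub>ring_of TYPE('a)\<^esub> S \<subseteq> J"
    by (rule genideal_minimal)
qed

lemma ideal_power_0: "ideal_power I 0 = (UNIV :: 'a::comm_ring_1 set)"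
  by (simp add: ideal_power_def ideals_set_def ring_of_type_algebra_def nat_pow_def)

lemma ideal_power_Suc:
  fixes I :: "'a::comm_ring_1 set"
  shows "ideal_power I (Suc s) = ideal_prod (ring_of TYPE('a)) (ideal_power I s) I"
  by (simp add: ideal_power_def ideals_set_def nat_pow_def)

lemma ideal_ideal_power:
  fixes I :: "'a::comm_ring_1 set"
  assumes "ideal I (ring_of TYPE('a))"
  shows "ideal (ideal_power I s) (ring_of TYPE('a))"
proof -
  interpret ring "ring_of TYPE('a)" by (rule ring_from_type_algebra)
  show ?thesis
  proof (induction s)
    case 0
    then show ?case by (simp add: ideal_power_0 ideal_ring_of_iff)
  next
    case (Suc s)
    then show ?case unfolding ideal_power_Suc by (rule ideal_prod_is_ideal[OF _ assms])
  qed
qed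

lemma mult_mem_ideal_power_Suc:
  fixes I :: "'a::comm_ring_1 set"
  assumes "a \<in> ideal_power I s" "b \<in> I"
  shows "a * b \<in> ideal_power I (Suc s)"
  using ideal_prod.prod[OF assms, of "ring_of TYPE('a)"]
  unfolding ideal_power_Suc by (simp add: ring_of_type_algebra_def)

lemma ideal_power_Suc_subset:
  fixes I J :: "'a::comm_ring_1 set"
  assumes "ideal J (ring_of TYPE('a))"
    and "\<And>a b. a \<in> ideal_power I s \<Longrightarrow> b \<in> I \<Longrightarrow> a * b \<in> J"
  shows "ideal_power I (Suc s) \<subseteq> J"
proof
  fix x assume "x \<in> ideal_power I (Suc s)"
  then show "x \<in> J"
    unfolding ideal_power_Suc
    by (induction rule: ideal_prod.induct)
      (use assms(2) idealD[OF assms(1)] in \<open>auto simp: ring_of_type_algebra_def\<close>)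
qed

section \<open>Contraction from a localization\<close>

text \<open>
  The fractions with numerator in \<open>J\<close> and denominator outside \<open>p\<close> already form an ideal of the
  localization, so they are the extension of \<open>J\<close>; clearing the denominator gives the contraction.
\<close>

lemma contract_extend:
  fixes p J :: "'a::idom set"
  assumes p: "primeideal p (ring_of TYPE('a))" and J: "ideal J (ring_of TYPE('a))"
  shows "contract (extend p J) = {f. \<exists>g. g \<notin> p \<and> g * f \<in> J}"
proof -
  have p0: "0 \<in> p" and p1: "1 \<notin> p" and pm: "\<And>a b. a * b \<in> p \<Longrightarrow> a \<in> p \<or> b \<in> p"
    using p by (auto simp: primeideal_ring_of_iff ideal_ring_of_iff)
  have nz: "g \<noteq> 0" if "g \<notin> p" for g using that p0 by blast
  let ?R = "localization p"
  have carr: "carrier ?R = {Fract a g | a g. g \<notin> p}"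
    and ops: "x \<otimes>\<^bsub>?R\<^esub> y = x * y" "x \<oplus>\<^bsub>?R\<^esub> y = x + y" "\<zero>\<^bsub>?R\<^esub> = 0" "\<one>\<^bsub>?R\<^esub> = 1" for x y
    by (simp_all add: localization_def ring_of_type_algebra_def)
  have carr_add: "x + y \<in> carrier ?R" if "x \<in> carrier ?R" "y \<in> carrier ?R" for x y
    using that nz pm unfolding carr by clarify (metis add_fract)
  have carr_mult: "x * y \<in> carrier ?R" if "x \<in> carrier ?R" "y \<in> carrier ?R" for x y
    using that pm unfolding carr by clarify (metis mult_fract)
  have carr_uminus: "- x \<in> carrier ?R" if "x \<in> carrier ?R" for x
    using that unfolding carr by clarify (metis minus_fract)
  have carr_of: "Fract a 1 \<in> carrier ?R" for a
    using p1 unfolding carr by blast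
  have carr01: "0 \<in> carrier ?R" "1 \<in> carrier ?R"
    using carr_of[of 0] carr_of[of 1] by (simp_all add: fract_collapse)
  have ring: "ring ?R"
  proof (rule ringI)
    show "abelian_group ?R"
    proof (rule abelian_groupI)
      show "\<exists>y\<in>carrier ?R. y \<oplus>\<^bsub>?R\<^esub> x = \<zero>\<^bsub>?R\<^esub>" if "x \<in> carrier ?R" for x
        using carr_uminus[OF that] by (intro bexI[of _ "- x"]) (simp_all add: ops)
    qed (simp_all add: ops carr_add carr01 algebra_simps)
    show "Group.monoid ?R"
      by (rule monoidI) (simp_all add: ops carr_mult carr01 algebra_simps)
  qed (simp_all add: ops algebra_simps)
  \<comment> \<open>the ideal that turns out to be the extension of \<open>J\<close>\<close>
  define E where "E = {Fract a g | a g. a \<in> J \<and> g \<notin> p}"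
  have E_add: "x + y \<in> E" if xy: "x \<in> E" "y \<in> E" for x y
  proof -
    obtain a g b h where *: "x = Fract a g" "y = Fract b h" "a \<in> J" "b \<in> J" "g \<notin> p" "h \<notin> p"
      using xy unfolding E_def by blast
    then have "x + y = Fract (a * h + b * g) (g * h)" using nz by (simp add: add_fract)
    moreover have "a * h + b * g \<in> J" "g * h \<notin> p"
      using * pm idealD[OF J] by (auto simp: mult.commute)
    ultimately show ?thesis unfolding E_def by blast
  qed
  have E_mult: "x * y \<in> E" if xy: "x \<in> carrier ?R" "y \<in> E" for x y
  proof -
    obtain a g b h where *: "x = Fract a g" "y = Fract b h" "b \<in> J" "g \<notin> p" "h \<notin> p"
      using xy unfolding E_def carr by blast
    then have "x * y = Fract (a * b) (g * h)" by simp
    moreover have "a * b \<in> J" "g * h \<notin> p"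
      using * pm idealD[OF J] by auto
    ultimately show ?thesis unfolding E_def by blast
  qed
  have E_carr: "E \<subseteq> carrier ?R" unfolding E_def carr by blast
  have E0: "0 \<in> E"
  proof -
    have "0 = Fract 0 1" "0 \<in> J"
      using idealD[OF J] by (simp_all add: fract_collapse)
    then show ?thesis unfolding E_def using p1 by blast
  qed
  have idE: "ideal E ?R"
  proof (rule idealI[OF ring])
    interpret ring ?R by (rule ring)
    show "subgroup E (add_monoid ?R)"
    proof (rule add.subgroupI)
      fix x assume x: "x \<in> E"
      then have xc: "x \<in> carrier ?R" using E_carr by blast
      have "\<ominus>\<^bsub>?R\<^esub> x = - x"
        by (rule minus_equality) (use xc carr_uminus in \<open>simp_all add: ops\<close>)
      moreover have "- 1 * x \<in> E"
        by (rule E_mult[OF _ x]) (use carr_uminus carr01 in blast)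
      ultimately show "\<ominus>\<^bsub>?R\<^esub> x \<in> E" by simp
    qed (use E_carr E0 E_add in \<open>auto simp: ops\<close>)
    show "x \<otimes>\<^bsub>?R\<^esub> a \<in> E" "a \<otimes>\<^bsub>?R\<^esub> x \<in> E" if "a \<in> E" "x \<in> carrier ?R" for a x
      using E_mult[OF that(2,1)] by (simp_all add: ops mult.commute)
  qed
  have "(\<lambda>a. Fract a 1) ` J \<subseteq> E" unfolding E_def using p1 by blast
  then have sub: "extend p J \<subseteq> E"
    unfolding extend_def genideal_def using idE by blast
  show ?thesis
  proof (intro subset_antisym subsetI)
    fix f assume "f \<in> contract (extend p J)"
    then have "Fract f 1 \<in> E" using sub by (auto simp: contract_def)
    then obtain a g where *: "Fract f 1 = Fract a g" "a \<in> J" "g \<notin> p"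
      unfolding E_def by blast
    then have "g * f = a" using nz[of g] by (simp add: eq_fract mult.commute)
    then show "f \<in> {f. \<exists>g. g \<notin> p \<and> g * f \<in> J}" using * by blast
  next
    fix f assume "f \<in> {f. \<exists>g. g \<notin> p \<and> g * f \<in> J}"
    then obtain g where g: "g \<notin> p" "g * f \<in> J" by blast
    have f_eq: "Fract f 1 = Fract 1 g \<otimes>\<^bsub>?R\<^esub> Fract (g * f) 1"
      using nz[OF g(1)] by (simp add: ops eq_fract)
    have "Fract 1 g \<in> carrier ?R" using g(1) unfolding carr by blast
    then have "Fract f 1 \<in> L" if "ideal L ?R" "(\<lambda>a. Fract a 1) ` J \<subseteq> L" for L
      unfolding f_eq using ideal.I_l_closed[OF that(1)] that(2) g(2) by blast
    then show "f \<in> contract (extend p J)"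
      by (simp add: contract_def extend_def genideal_def)
  qed
qed

section \<open>Polynomials as sums of monomials\<close>

lemma sum_single_keys: "f = (\<Sum>a\<in>Poly_Mapping.keys f. Poly_Mapping.single a (Poly_Mapping.lookup f a))"
  (is "f = ?S")
proof (rule poly_mapping_eqI)
  fix k
  have "Poly_Mapping.lookup ?S k = (\<Sum>a\<in>Poly_Mapping.keys f. Poly_Mapping.lookup f a when a = k)"
    by (simp add: lookup_sum lookup_single)
  also have "\<dots> = (\<Sum>a\<in>Poly_Mapping.keys f. if k = a then Poly_Mapping.lookup f a else 0)"
    by (rule sum.cong) (auto simp: when_def)
  also have "\<dots> = Poly_Mapping.lookup f k"
    by (simp add: in_keys_iff)
  finally show "Poly_Mapping.lookup f k = Poly_Mapping.lookup ?S k" ..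
qed

lemma single_eq_const_mult_monomial:
  "Poly_Mapping.single a c = Poly_Mapping.single 0 c * monomial a"
  by (simp add: monomial_def mult_single)

lemma monomial_add: "monomial (a + b) = monomial a * monomial b"
  by (simp add: monomial_def mult_single)

lemma mult_mem_ideal_if_monomials:
  fixes J :: "('x::type, 'k::comm_ring_1) mpoly set"
  assumes J: "ideal J (ring_of TYPE(('x, 'k) mpoly))"
    and mono: "\<And>a. a \<in> Poly_Mapping.keys f \<Longrightarrow> g * monomial a \<in> J"
  shows "g * f \<in> J"
proof -
  have "g * f = (\<Sum>a\<in>Poly_Mapping.keys f. Poly_Mapping.single 0 (Poly_Mapping.lookup f a) * (g * monomial a))"
  proof -
    have "g * f = g * (\<Sum>a\<in>Poly_Mapping.keys f. Poly_Mapping.single a (Poly_Mapping.lookup f a))"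
      by (rule arg_cong[OF sum_single_keys])
    moreover have "g * Poly_Mapping.single a c = Poly_Mapping.single 0 c * (g * monomial a)" for a c
      unfolding single_eq_const_mult_monomial[of a c] by (rule mult.left_commute)
    ultimately show ?thesis
      by (simp add: sum_distrib_left)
  qed
  also have "\<dots> \<in> J"
    by (rule ideal_sum_mem[OF J]) (use mono idealD[OF J] in blast)
  finally show ?thesis .
qed

section \<open>Primes generated by variables and their powers\<close>

definition weight :: "'x set \<Rightarrow> ('x \<Rightarrow>\<^sub>0 nat) \<Rightarrow> nat"
  where "weight C a = (\<Sum>i\<in>C. Poly_Mapping.lookup a i)"

lemma weight_add: "weight C (a + b) = weight C a + weight C b"
  by (simp add: weight_def lookup_add sum.distrib)

text \<open>
  The \<open>s\<close>-th power of the ideal generated by the variables in \<open>C\<close>, described by its monomials.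
\<close>

definition coordinate_power :: "'x set \<Rightarrow> nat \<Rightarrow> ('x, 'k::comm_ring_1) mpoly set"
  where "coordinate_power C s = {f. \<forall>a\<in>Poly_Mapping.keys f. s \<le> weight C a}"

text \<open>
  The exponent is \<open>Suc 0\<close> because simplification rewrites \<open>1\<close> to it.
\<close>

abbreviation coordinate_prime :: "'x set \<Rightarrow> ('x, 'k::comm_ring_1) mpoly set"
  where "coordinate_prime C \<equiv> coordinate_power C (Suc 0)"

lemma coordinate_power_add:
  "f \<in> coordinate_power C s \<Longrightarrow> g \<in> coordinate_power C s \<Longrightarrow> f + g \<in> coordinate_power C s"
  using keys_add[of f g] by (auto simp: coordinate_power_def)

lemma coordinate_power_mult:
  "f \<in> coordinate_power C s \<Longrightarrow> g \<in> coordinate_power C t \<Longrightarrow> f * g \<in> coordinate_power C (s + t)"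
  using keys_mult[of f g] by (force simp: coordinate_power_def weight_add intro: add_mono)

lemma coordinate_power_0: "coordinate_power C 0 = UNIV"
  by (simp add: coordinate_power_def)

lemma coordinate_power_antimono: "s \<le> t \<Longrightarrow> coordinate_power C t \<subseteq> coordinate_power C s"
  by (auto simp: coordinate_power_def)

lemma monomial_mem_coordinate_power:
  "(monomial a :: ('x, 'k::comm_ring_1) mpoly) \<in> coordinate_power C s \<longleftrightarrow> s \<le> weight C a"
  by (simp add: coordinate_power_def monomial_def)

lemma ideal_coordinate_power:
  "ideal (coordinate_power C s :: ('x, 'k::comm_ring_1) mpoly set) (ring_of TYPE(('x, 'k) mpoly))"
  unfolding ideal_ring_of_iff
  using coordinate_power_add coordinate_power_mult[of _ C 0 _ s]
  by (auto simp: coordinate_power_0) (simp add: coordinate_power_def)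

lemma power_mem_coordinate_power:
  "f \<in> coordinate_prime C \<Longrightarrow> f ^ m \<in> coordinate_power C m"
  by (induction m) (auto simp: coordinate_power_0 dest: coordinate_power_mult[of f C "Suc 0"])

text \<open>
  The weight on \<open>C\<close> behaves like a valuation.  The components of \<open>f\<close> and \<open>g\<close> of weight \<open>p\<close> and \<open>q\<close> are
  nonzero, and so is their product, because polynomials form a domain; it is the component of weight
  \<open>p + q\<close> of \<open>f * g\<close>.
\<close>

lemma lowest_forms_multiply:
  fixes f g :: "('x::{finite,linorder}, 'k::field) mpoly"
  assumes f: "f \<in> coordinate_power C p" "f \<notin> coordinate_power C (Suc p)"
    and g: "g \<in> coordinate_power C q" "g \<notin> coordinate_power C (Suc q)"
  shows "f * g \<notin> coordinate_power C (Suc (p + q))"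
proof
  assume fg: "f * g \<in> coordinate_power C (Suc (p + q))"
  define part :: "nat \<Rightarrow> ('x, 'k) mpoly \<Rightarrow> ('x, 'k) mpoly" where
    "part r u = Poly_Mapping.mapp (\<lambda>a c. c when weight C a = r) u" for r u
  have lookup_part: "Poly_Mapping.lookup (part r u) a = (if weight C a = r then Poly_Mapping.lookup u a else 0)"
    for r u a
    by (auto simp: part_def lookup_mapp when_def in_keys_iff)
  have keys_part: "a \<in> Poly_Mapping.keys (part r u) \<longleftrightarrow> weight C a = r \<and> a \<in> Poly_Mapping.keys u" for r u a
    by (simp add: in_keys_iff lookup_part)
  have rest: "u - part r u \<in> coordinate_power C (Suc r)" if "u \<in> coordinate_power C r" for r u
    unfolding coordinate_power_def
  proof (clarify)
    fix a assume a: "a \<in> Poly_Mapping.keys (u - part r u)"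
    then have "weight C a \<noteq> r" "a \<in> Poly_Mapping.keys u"
      by (auto simp: in_keys_iff lookup_minus lookup_part split: if_splits)
    then show "Suc r \<le> weight C a"
      using that by (fastforce simp: coordinate_power_def)
  qed
  have part_nz: "part r u \<noteq> 0" if "u \<in> coordinate_power C r" "u \<notin> coordinate_power C (Suc r)" for r u
    using rest[OF that(1)] that(2) by auto
  have part_mem: "part r u \<in> coordinate_power C r" for r u
    by (simp add: coordinate_power_def keys_part)
  have "part p f * part q g \<noteq> 0"
    using part_nz f g by simp
  then obtain c where c: "c \<in> Poly_Mapping.keys (part p f * part q g)"
    by (metis keys_eq_empty ex_in_conv)
  then have wc: "weight C c = p + q"
    using keys_mult[of "part p f" "part q g"] by (auto simp: keys_part weight_add)
  have "part p f * part q g = f * g + (- 1) * (part p f * (g - part q g)) + (- 1) * ((f - part p f) * g)"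
    by (simp add: algebra_simps)
  also have "\<dots> \<in> coordinate_power C (Suc (p + q))"
  proof -
    have "part p f * (g - part q g) \<in> coordinate_power C (Suc (p + q))"
      using coordinate_power_mult[OF part_mem rest[OF g(1)]] by simp
    moreover have "(f - part p f) * g \<in> coordinate_power C (Suc (p + q))"
      using coordinate_power_mult[OF rest[OF f(1)] g(1)] by simp
    ultimately show ?thesis
      using fg idealD[OF ideal_coordinate_power] by blast
  qed
  finally show False
    using c wc by (auto simp: coordinate_power_def)
qed

text \<open>
  If \<open>f\<close> has lowest weight \<open>r < s\<close>, then so has \<open>g * f\<close>, because \<open>g\<close> has lowest weight \<open>0\<close>.
\<close>

lemma coordinate_power_primary:
  fixes f g :: "('x::{finite,linorder}, 'k::field) mpoly"
  assumes "g * f \<in> coordinate_power C s" "g \<notin> coordinate_prime C"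
  shows "f \<in> coordinate_power C s"
proof (rule ccontr)
  assume f: "f \<notin> coordinate_power C s"
  define q where "q = (LEAST r. f \<notin> coordinate_power C r)"
  have q: "f \<notin> coordinate_power C q" "q \<le> s"
    unfolding q_def by (rule LeastI[of _ s], rule f) (rule Least_le, rule f)
  then obtain r where r: "q = Suc r"
    by (cases q) (auto simp: coordinate_power_0)
  have "f \<in> coordinate_power C r"
    using not_less_Least[of r "\<lambda>r. f \<notin> coordinate_power C r"] r unfolding q_def by auto
  then have "g * f \<notin> coordinate_power C (Suc (0 + r))"
    using assms(2) q r by (intro lowest_forms_multiply) (auto simp: coordinate_power_0)
  then show False
    using assms(1) coordinate_power_antimono[OF q(2)] r by auto
qed

lemma one_mem_coordinate_power:
  "(1 :: ('x, 'k::comm_ring_1) mpoly) \<in> coordinate_power C s \<longleftrightarrow> s = 0"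
  using monomial_mem_coordinate_power[of 0 C s] by (simp add: monomial_def weight_def)

lemma primeideal_coordinate_prime:
  "primeideal (coordinate_prime C) (ring_of TYPE(('x::{finite,linorder}, 'k::field) mpoly))"
  unfolding primeideal_ring_of_iff
  using coordinate_power_primary[of _ _ C "Suc 0"] ideal_coordinate_power[of C "Suc 0"]
  by (auto simp: one_mem_coordinate_power)

definition variable :: "'x \<Rightarrow> ('x \<Rightarrow>\<^sub>0 nat)"
  where "variable i = Poly_Mapping.single i 1"

lemma weight_variable: "finite C \<Longrightarrow> weight C (variable i) = of_bool (i \<in> C)"
  by (simp add: weight_def variable_def lookup_single when_def)

lemma split_off_variable:
  assumes "0 < Poly_Mapping.lookup b i"
  obtains b' where "b = variable i + b'"
proof
  show "b = variable i + (b - variable i)"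
    by (rule poly_mapping_eqI) (use assms in \<open>auto simp: lookup_add lookup_minus variable_def lookup_single when_def\<close>)
qed

lemma coordinate_prime_subset:
  fixes p :: "('x::{finite,linorder}, 'k::field) mpoly set"
  assumes p: "ideal p (ring_of TYPE(('x, 'k) mpoly))"
    and vars: "\<And>i. i \<in> C \<Longrightarrow> monomial (variable i) \<in> p"
  shows "coordinate_prime C \<subseteq> p"
proof
  fix f :: "('x, 'k) mpoly" assume f: "f \<in> coordinate_prime C"
  have "1 * f \<in> p"
  proof (rule mult_mem_ideal_if_monomials[OF p])
    fix a assume "a \<in> Poly_Mapping.keys f"
    then have "1 \<le> weight C a" using f by (simp add: coordinate_power_def)
    then obtain i where i: "i \<in> C" "0 < Poly_Mapping.lookup a i"
      by (metis weight_def sum.neutral not_gr_zero not_one_le_zero)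
    then obtain b where "a = variable i + b" using split_off_variable by metis
    then show "1 * monomial a \<in> p"
      using vars[OF i(1)] idealD[OF p] by (simp add: monomial_add mult.commute[of "monomial (variable i)"])
  qed
  then show "f \<in> p" by simp
qed

lemma prime_contains_some_variable:
  fixes p :: "('x::{finite,linorder}, 'k::field) mpoly set"
  assumes p: "primeideal p (ring_of TYPE(('x, 'k) mpoly))" and a: "monomial a \<in> p"
  shows "\<exists>i. 0 < Poly_Mapping.lookup a i \<and> monomial (variable i) \<in> p"
  using a
proof (induction "weight UNIV a" arbitrary: a)
  case 0
  then have "a = 0"
    by (intro poly_mapping_eqI) (simp add: weight_def)
  then have "1 \<in> p" using 0 by (simp add: monomial_def)
  then show ?case using p by (simp add: primeideal_ring_of_iff)
next
  case (Suc w)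
  then have "\<exists>i. 0 < Poly_Mapping.lookup a i"
    by (metis weight_def sum.neutral not_gr_zero nat.distinct(1))
  then obtain i where i: "0 < Poly_Mapping.lookup a i" ..
  then obtain b where b: "a = variable i + b" using split_off_variable by metis
  then consider "monomial (variable i) \<in> p" | "monomial b \<in> p"
    using Suc.prems p by (auto simp: monomial_add primeideal_ring_of_iff)
  then show ?case
  proof cases
    case 2
    have "w = weight UNIV b"
      using Suc.hyps(2) by (simp add: b weight_add weight_variable)
    then obtain j where "0 < Poly_Mapping.lookup b j" "monomial (variable j) \<in> p"
      using Suc.hyps(1) 2 by blast
    then show ?thesis
      by (intro exI[of _ j]) (simp add: b lookup_add)
  qed (use i in blast)
qed

section \<open>Heights of primes in a polynomial ring\<close>

definition power_product :: "'a::comm_ring_1 list \<Rightarrow> nat list \<Rightarrow> 'a"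
  where "power_product fs es = prod_list (map2 (^) fs es)"

lemma power_product_simps [simp]:
  "power_product [] es = 1" "power_product (f # fs) (e # es) = f ^ e * power_product fs es"
  by (simp_all add: power_product_def)

definition exponents :: "nat \<Rightarrow> nat \<Rightarrow> nat list set"
  where "exponents N m = {es. set es \<subseteq> {..<N} \<and> length es = m}"

lemma finite_exponents: "finite (exponents N m)"
  unfolding exponents_def by (rule finite_lists_length_eq) simp

lemma card_exponents: "card (exponents N m) = N ^ m"
  unfolding exponents_def by (simp add: card_lists_length_eq)

lemma sum_exponents_Suc:
  fixes g :: "nat list \<Rightarrow> 'a::comm_monoid_add"
  shows "(\<Sum>es\<in>exponents N (Suc m). g es) = (\<Sum>e<N. \<Sum>es\<in>exponents N m. g (e # es))"
proof -
  have "exponents N (Suc m) = (\<lambda>(e, es). e # es) ` ({..<N} \<times> exponents N m)"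
    by (auto simp: exponents_def length_Suc_conv)
  moreover have "inj_on (\<lambda>(e, es). e # es) ({..<N} \<times> exponents N m)"
    by (auto simp: inj_on_def)
  ultimately show ?thesis
    by (simp add: sum.reindex sum.cartesian_product case_prod_unfold)
qed

text \<open>
  Choose \<open>f\<^sub>i \<in> c (i + 1) - c i\<close>; then the \<open>f\<^sub>i\<close> are algebraically independent, even modulo \<open>c 0\<close>.  Indeed,
  write a relation modulo \<open>c 0\<close> as a sum of \<open>f\<^sub>0\<^sup>e S\<^sub>e\<close> with \<open>S\<^sub>e\<close> a combination of power products of the
  other \<open>f\<^sub>i\<close>, and let \<open>j\<close> be the first index for which \<open>S\<^sub>j\<close> has a nonzero coefficient.  Since \<open>f\<^sub>0\<close> is
  not in the prime \<open>c 0\<close>, the factor \<open>f\<^sub>0\<^sup>j\<close> may be cancelled, and what remains is \<open>S\<^sub>j\<close> modulo \<open>f\<^sub>0 \<in> c 1\<close>.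
  So \<open>S\<^sub>j\<close> is a relation modulo \<open>c 1\<close>, and induction applies to the chain that starts at \<open>c 1\<close>.
  Exponents are bounded by \<open>N\<close> to have finite sums.
\<close>

lemma chain_gives_independent_power_products:
  fixes c :: "nat \<Rightarrow> ('x::{finite,linorder}, 'k::field) mpoly set"
  assumes "\<And>i. i \<le> m \<Longrightarrow> primeideal (c i) (ring_of TYPE(('x, 'k) mpoly))"
    and "\<And>i. i < m \<Longrightarrow> c i \<subset> c (Suc i)"
  shows "\<exists>fs. length fs = m \<and> (\<forall>N u.
    (\<Sum>es\<in>exponents N m. Poly_Mapping.single 0 (u es) * power_product fs es) \<in> c 0 \<longrightarrow>
    (\<forall>es\<in>exponents N m. u es = 0))"
  using assms
proof (induction m arbitrary: c)
  case 0
  have "u [] = 0" if "Poly_Mapping.single 0 (u []) \<in> c 0" for u :: "nat list \<Rightarrow> 'k"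
  proof (rule ccontr)
    assume "u [] \<noteq> 0"
    then have "Poly_Mapping.single 0 (inverse (u [])) * Poly_Mapping.single 0 (u []) = (1 :: ('x, 'k) mpoly)"
      by (simp add: mult_single)
    then show False
      using 0(1)[of 0] that by (metis primeideal_ring_of_iff idealD le_refl)
  qed
  moreover have "exponents N 0 = {[]}" for N
    by (auto simp: exponents_def)
  ultimately show ?case
    by (intro exI[of _ "[]"]) simp
next
  case (Suc m)
  have p0: "primeideal (c 0) (ring_of TYPE(('x, 'k) mpoly))" and p1: "primeideal (c 1) (ring_of TYPE(('x, 'k) mpoly))"
    using Suc.prems(1)[of 0] Suc.prems(1)[of 1] by simp_all
  have i1: "ideal (c 1) (ring_of TYPE(('x, 'k) mpoly))"
    using p1 by (simp add: primeideal_ring_of_iff)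
  have "\<exists>fs. length fs = m \<and> (\<forall>N u.
    (\<Sum>es\<in>exponents N m. Poly_Mapping.single 0 (u es) * power_product fs es) \<in> c (Suc 0) \<longrightarrow>
    (\<forall>es\<in>exponents N m. u es = 0))"
    by (rule Suc.IH) (use Suc.prems in auto)
  then obtain fs where fs: "length fs = m"
    "\<And>N u. (\<Sum>es\<in>exponents N m. Poly_Mapping.single 0 (u es) * power_product fs es) \<in> c 1 \<Longrightarrow>
      (\<forall>es\<in>exponents N m. u es = 0)"
    by auto
  obtain f where f: "f \<in> c 1" "f \<notin> c 0"
    using Suc.prems(2)[of 0] by auto
  have c01: "c 0 \<subseteq> c 1" using Suc.prems(2)[of 0] by auto
  have "u es = 0"
    if u: "(\<Sum>es\<in>exponents N (Suc m). Poly_Mapping.single 0 (u es) * power_product (f # fs) es) \<in> c 0"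
      and es: "es \<in> exponents N (Suc m)" for N u es
  proof -
    define S where "S e = (\<Sum>es\<in>exponents N m. Poly_Mapping.single 0 (u (e # es)) * power_product fs es)" for e
    have total: "(\<Sum>e<N. f ^ e * S e) \<in> c 0"
      using u by (simp add: sum_exponents_Suc S_def sum_distrib_left mult.left_commute)
    have "\<forall>es\<in>exponents N m. u (j # es) = 0" if "j < N" for j
      using that
    proof (induction j rule: less_induct)
      case (less j)
      have S0: "S e = 0" if "e < j" for e
        using less that by (simp add: S_def)
      have "(\<Sum>e<N. f ^ e * S e) = (\<Sum>e\<in>{j..<N}. f ^ e * S e)"
        by (rule sum.mono_neutral_right) (use S0 in auto)
      also have "\<dots> = f ^ j * S j + (\<Sum>e\<in>{Suc j..<N}. f ^ e * S e)"
        using less.prems by (simp add: sum.atLeast_Suc_lessThan)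
      also have "(\<Sum>e\<in>{Suc j..<N}. f ^ e * S e) = (\<Sum>e\<in>{Suc j..<N}. f ^ j * (f * (f ^ (e - Suc j) * S e)))"
      proof (rule sum.cong[OF refl])
        fix e assume "e \<in> {Suc j..<N}"
        then have "f ^ e = f ^ j * (f * f ^ (e - Suc j))"
          by (simp flip: power_Suc power_add)
        then show "f ^ e * S e = f ^ j * (f * (f ^ (e - Suc j) * S e))"
          by (simp add: mult.assoc)
      qed
      finally have "(\<Sum>e<N. f ^ e * S e) = f ^ j * (S j + (\<Sum>e\<in>{Suc j..<N}. f ^ (e - Suc j) * S e) * f)"
        by (simp add: sum_distrib_left sum_distrib_right distrib_left ac_simps)
      then have "S j + (\<Sum>e\<in>{Suc j..<N}. f ^ (e - Suc j) * S e) * f \<in> c 0"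
        using total p0 f(2) prime_power_mem[OF p0, of f j] by (auto simp: primeideal_ring_of_iff)
      then have sum1: "S j + (\<Sum>e\<in>{Suc j..<N}. f ^ (e - Suc j) * S e) * f \<in> c 1" (is "S j + ?T * f \<in> _")
        using c01 by blast
      have "(- ?T) * f \<in> c 1"
        using f(1) idealD[OF i1] by blast
      then have "(S j + ?T * f) + (- ?T) * f \<in> c 1"
        using sum1 idealD[OF i1] by blast
      then have "S j \<in> c 1" by simp
      then show ?case unfolding S_def by (rule fs(2))
    qed
    then show ?thesis
      using es by (auto simp: exponents_def length_Suc_conv)
  qed
  then show ?case
    using fs(1) by (intro exI[of _ "f # fs"]) auto
qed

definition exponent_bounded :: "nat \<Rightarrow> ('x, 'k::comm_ring_1) mpoly \<Rightarrow> bool"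
  where "exponent_bounded d f \<longleftrightarrow> (\<forall>a\<in>Poly_Mapping.keys f. \<forall>i. Poly_Mapping.lookup a i \<le> d)"

lemma exponent_bounded_mono: "exponent_bounded d f \<Longrightarrow> d \<le> e \<Longrightarrow> exponent_bounded e f"
  by (meson exponent_bounded_def le_trans)

lemma exponent_bounded_mult:
  "exponent_bounded d f \<Longrightarrow> exponent_bounded e g \<Longrightarrow> exponent_bounded (d + e) (f * g)"
  using keys_mult[of f g] by (force simp: exponent_bounded_def lookup_add intro: add_mono)

lemma exponent_bounded_one: "exponent_bounded d 1"
  by (simp add: exponent_bounded_def)

lemma exponent_bounded_power: "exponent_bounded d f \<Longrightarrow> exponent_bounded (k * d) (f ^ k)"
  by (induction k) (simp_all add: exponent_bounded_one exponent_bounded_mult)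

lemma exponent_bounded_power_product:
  assumes "\<And>f. f \<in> set fs \<Longrightarrow> exponent_bounded d f" "es \<in> exponents N (length fs)"
  shows "exponent_bounded (length fs * (N * d)) (power_product fs es)"
  using assms
proof (induction fs arbitrary: es)
  case (Cons f fs)
  then obtain e es' where es: "es = e # es'" "e < N" "es' \<in> exponents N (length fs)"
    by (auto simp: exponents_def length_Suc_conv)
  have "exponent_bounded (N * d) (f ^ e)"
    by (rule exponent_bounded_mono[OF exponent_bounded_power[of d]]) (use Cons.prems es in auto)
  moreover have "exponent_bounded (length fs * (N * d)) (power_product fs es')"
    by (rule Cons.IH) (use Cons.prems es in auto)
  ultimately show ?case
    using exponent_bounded_mult by (fastforce simp: es)
qed (simp add: exponent_bounded_one)

lemma exists_exponent_bound:
  fixes fs :: "('x::finite, 'k::comm_ring_1) mpoly list"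
  shows "\<exists>d. \<forall>f\<in>set fs. exponent_bounded d f"
proof (induction fs)
  case (Cons f fs)
  then obtain d where d: "\<forall>f\<in>set fs. exponent_bounded d f" by blast
  define e where "e = (\<Sum>a\<in>Poly_Mapping.keys f. weight UNIV a)"
  have "Poly_Mapping.lookup a i \<le> e" if "a \<in> Poly_Mapping.keys f" for a i
  proof -
    have "Poly_Mapping.lookup a i \<le> weight UNIV a"
      unfolding weight_def by (rule member_le_sum) auto
    also have "\<dots> \<le> e"
      unfolding e_def by (rule member_le_sum) (use that in auto)
    finally show ?thesis .
  qed
  then have "exponent_bounded e f" by (simp add: exponent_bounded_def)
  then show ?case
    using d exponent_bounded_mono by (intro exI[of _ "max d e"]) (auto intro: exponent_bounded_mono)
qed simp

lemma card_bounded_exponents: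
  "finite {a :: 'x::finite \<Rightarrow>\<^sub>0 nat. \<forall>i. Poly_Mapping.lookup a i \<le> d}"
  "card {a :: 'x::finite \<Rightarrow>\<^sub>0 nat. \<forall>i. Poly_Mapping.lookup a i \<le> d} \<le> Suc d ^ CARD('x)"
proof -
  let ?S = "{a :: 'x \<Rightarrow>\<^sub>0 nat. \<forall>i. Poly_Mapping.lookup a i \<le> d}"
  have inj: "inj_on Poly_Mapping.lookup ?S"
    by (auto simp: inj_on_def intro: poly_mapping_eqI)
  have sub: "Poly_Mapping.lookup ` ?S \<subseteq> PiE UNIV (\<lambda>_. {..d})"
    by auto
  have fin: "finite (PiE (UNIV :: 'x set) (\<lambda>_. {..d}))"
    by (rule finite_PiE) auto
  show "finite ?S"
    using inj sub fin by (metis finite_imageD finite_subset)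
  have "card ?S \<le> card (PiE (UNIV :: 'x set) (\<lambda>_. {..d}))"
    by (rule card_inj_on_le[OF inj sub fin])
  then show "card ?S \<le> Suc d ^ CARD('x)"
    by (simp add: card_PiE)
qed

lemma vector_space_mpoly:
  "vector_space (\<lambda>(k::'k::field) f :: ('x::{finite,linorder}, 'k) mpoly. Poly_Mapping.single 0 k * f)"
  by unfold_locales (simp_all add: algebra_simps single_add mult_single flip: mult.assoc)

text \<open>
  The \<open>N ^ length fs\<close> power products are linearly independent, and they lie in the span of the monomials
  with all exponents at most \<open>length fs * (N * d)\<close>; so there are no more of the former than of the latter.
\<close>

lemma card_independent_power_products:
  fixes fs :: "('x::{finite,linorder}, 'k::field) mpoly list"
  assumes bound: "\<And>f. f \<in> set fs \<Longrightarrow> exponent_bounded d f"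
    and indep: "\<And>u. (\<Sum>es\<in>exponents N (length fs). Poly_Mapping.single 0 (u es) * power_product fs es) = 0 \<Longrightarrow>
      \<forall>es\<in>exponents N (length fs). u es = 0"
  shows "N ^ length fs \<le> Suc (length fs * (N * d)) ^ CARD('x)"
proof -
  let ?E = "exponents N (length fs)" and ?P = "power_product fs"
  let ?d = "length fs * (N * d)"
  interpret V: vector_space "\<lambda>(k::'k) f :: ('x, 'k) mpoly. Poly_Mapping.single 0 k * f"
    by (rule vector_space_mpoly)
  have inj: "inj_on ?P ?E"
  proof (rule inj_onI, rule ccontr)
    fix v w assume vw: "v \<in> ?E" "w \<in> ?E" "?P v = ?P w" "v \<noteq> w"
    \<comment> \<open>Equal power products for different exponents would be a relation.\<close>
    define u :: "nat list \<Rightarrow> 'k" where "u es = (if es = v then 1 else if es = w then - 1 else 0)" for es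
    have "(\<Sum>es\<in>?E. Poly_Mapping.single 0 (u es) * ?P es) = (\<Sum>es\<in>{v, w}. Poly_Mapping.single 0 (u es) * ?P es)"
      by (rule sum.mono_neutral_right) (use vw finite_exponents in \<open>auto simp: u_def\<close>)
    also have "\<dots> = 0"
      using vw by (simp add: u_def single_uminus)
    finally have "u v = 0" using indep vw(1) by blast
    then show False by (simp add: u_def)
  qed
  have "V.independent (?P ` ?E)"
  proof (rule V.independent_if_scalars_zero)
    show "finite (?P ` ?E)" by (simp add: finite_exponents)
    fix u :: "('x, 'k) mpoly \<Rightarrow> 'k" and x
    assume "(\<Sum>x\<in>?P ` ?E. Poly_Mapping.single 0 (u x) * x) = 0" and x: "x \<in> ?P ` ?E"
    then have "(\<Sum>es\<in>?E. Poly_Mapping.single 0 (u (?P es)) * ?P es) = 0"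
      by (simp add: sum.reindex[OF inj])
    then show "u x = 0" using indep[of "\<lambda>es. u (?P es)"] x by blast
  qed
  moreover define T :: "('x, 'k) mpoly set"
    where "T = monomial ` {a. \<forall>i. Poly_Mapping.lookup a i \<le> ?d}"
  have "?P ` ?E \<subseteq> V.span T"
  proof
    fix x assume "x \<in> ?P ` ?E"
    then have x: "exponent_bounded ?d x"
      using exponent_bounded_power_product[of fs d] bound by blast
    have "(\<Sum>a\<in>Poly_Mapping.keys x. Poly_Mapping.single 0 (Poly_Mapping.lookup x a) * monomial a) \<in> V.span T"
      by (intro V.span_sum V.span_scale V.span_base) (use x in \<open>auto simp: T_def exponent_bounded_def\<close>)
    then show "x \<in> V.span T"
      by (simp flip: single_eq_const_mult_monomial sum_single_keys)
  qed
  moreover have "finite T"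
    unfolding T_def by (intro finite_imageI card_bounded_exponents)
  ultimately have "card (?P ` ?E) \<le> card T"
    using V.independent_span_bound by blast
  also have "\<dots> \<le> Suc ?d ^ CARD('x)"
    unfolding T_def using card_image_le[OF card_bounded_exponents(1)] card_bounded_exponents(2) by (rule le_trans)
  finally show ?thesis
    by (simp add: card_image[OF inj] card_exponents)
qed

text \<open>
  For \<open>n + 1\<close> polynomials the number of power products grows like \<open>N\<^bsup>n+1\<^esup>\<close>, but the number of monomials
  available to them only like \<open>N\<^sup>n\<close>.
\<close>

lemma height_le_card:
  fixes p :: "('x::{finite,linorder}, 'k::field) mpoly set"
  shows "height p \<le> enat CARD('x)"
  unfolding height_def
proof (rule Sup_least, clarify)
  fix m and c :: "nat \<Rightarrow> ('x, 'k) mpoly set"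
  assume c: "\<forall>i\<le>m. primeideal (c i) (ring_of TYPE(('x, 'k) mpoly))" "\<forall>i<m. c i \<subset> c (Suc i)"
  let ?n = "CARD('x)"
  have "m \<le> ?n"
  proof (rule ccontr)
    assume "\<not> m \<le> ?n"
    then have "Suc ?n \<le> m" by simp
    then have "\<exists>fs. length fs = Suc ?n \<and> (\<forall>N u.
      (\<Sum>es\<in>exponents N (Suc ?n). Poly_Mapping.single 0 (u es) * power_product fs es) \<in> c 0 \<longrightarrow>
      (\<forall>es\<in>exponents N (Suc ?n). u es = 0))"
      using c by (intro chain_gives_independent_power_products) auto
    then obtain fs where fs: "length fs = Suc ?n"
      "\<And>N u. (\<Sum>es\<in>exponents N (Suc ?n). Poly_Mapping.single 0 (u es) * power_product fs es) \<in> c 0 \<Longrightarrow>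
        \<forall>es\<in>exponents N (Suc ?n). u es = 0"
      by blast
    have c0: "0 \<in> c 0"
      using c(1) by (auto simp: primeideal_ring_of_iff ideal_ring_of_iff)
    obtain d where d: "\<forall>f\<in>set fs. exponent_bounded d f"
      using exists_exponent_bound by blast
    \<comment> \<open>\<open>B\<close> is chosen so that the exponent bound is below \<open>N * B\<close>, and \<open>N\<close> so that \<open>N\<^bsup>n+1\<^esup> > (N * B)\<^sup>n\<close>.\<close>
    define B where "B = Suc (Suc ?n * d)"
    define N where "N = Suc (B ^ ?n)"
    have "N ^ length fs \<le> Suc (length fs * (N * d)) ^ ?n"
    proof (rule card_independent_power_products)
      show "\<forall>es\<in>exponents N (length fs). u es = 0"
        if "(\<Sum>es\<in>exponents N (length fs). Poly_Mapping.single 0 (u es) * power_product fs es) = 0" for u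
        using fs(2)[where N = N and u = u] fs(1) c0 that by simp
    qed (use d in blast)
    also have "\<dots> \<le> (N * B) ^ ?n"
      by (rule power_mono) (simp_all add: fs(1) B_def N_def algebra_simps)
    finally have "N ^ ?n * N \<le> N ^ ?n * B ^ ?n"
      by (simp add: fs(1) power_mult_distrib mult.commute)
    then show False
      by (simp add: N_def)
  qed
  then show "enat m \<le> enat ?n" by simp
qed


text \<open>
  Adding the variables of \<open>C\<close> one at a time gives a chain of primes.
\<close>

lemma height_coordinate_prime:
  "enat (card C) \<le> height (coordinate_prime C :: ('x::{finite,linorder}, 'k::field) mpoly set)"
proof -
  obtain xs where xs: "set xs = C" "distinct xs"
    using finite_distinct_list[of C] by auto
  define c :: "nat \<Rightarrow> ('x, 'k) mpoly set" where "c i = coordinate_prime (set (take i xs))" for i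
  have "c i \<subset> c (Suc i)" if i: "i < card C" for i
  proof -
    have len: "i < length xs" using i xs distinct_card by metis
    have new: "xs ! i \<notin> set (take i xs)"
      using xs(2) len by (fastforce simp: distinct_conv_nth in_set_conv_nth)
    have set_Suc: "set (take (Suc i) xs) = insert (xs ! i) (set (take i xs))"
      using len by (simp add: take_Suc_conv_app_nth)
    have "c i \<subseteq> c (Suc i)"
      unfolding c_def set_Suc using new
      by (auto simp: coordinate_power_def weight_def intro: trans_le_add2)
    moreover have "monomial (variable (xs ! i)) \<in> c (Suc i)" "monomial (variable (xs ! i)) \<notin> c i"
      using new by (simp_all add: c_def set_Suc monomial_mem_coordinate_power weight_variable)
    ultimately show ?thesis by blast
  qed
  moreover have "c (card C) = coordinate_prime C"
    using xs distinct_card[of xs] by (simp add: c_def)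
  moreover have "primeideal (c i) (ring_of TYPE(('x, 'k) mpoly))" for i
    unfolding c_def by (rule primeideal_coordinate_prime)
  ultimately show ?thesis
    unfolding height_def by (intro Sup_upper) blast
qed

section \<open>Symbolic powers of square-free monomial ideals\<close>

locale squarefree_generators =
  fixes A :: "('x::{finite,linorder} \<Rightarrow>\<^sub>0 nat) set" and I :: "('x, 'k::field) mpoly set"
  assumes squarefree: "a \<in> A \<Longrightarrow> Poly_Mapping.lookup a i \<le> 1"
    and generated: "I = Idl\<^bsub>ring_of TYPE(('x, 'k) mpoly)\<^esub> (monomial ` A)"
begin

text \<open>
  The minimal vertex covers of the supports of the generators, described by the primes that their
  variables generate.
\<close>

definition minimal_covers :: "'x set set"
  where "minimal_covers = {C. coordinate_prime C \<in> minimal_primes I}"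

lemma ideal_I: "ideal I (ring_of TYPE(('x, 'k) mpoly))"
  unfolding generated by (rule mem_genideal_ring_of)

lemma generator_mem: "a \<in> A \<Longrightarrow> monomial a \<in> I"
  using mem_genideal_ring_of(1)[of "monomial ` A"] unfolding generated by blast

lemma I_subset:
  assumes "ideal J (ring_of TYPE(('x, 'k) mpoly))" "\<And>a. a \<in> A \<Longrightarrow> monomial a \<in> J"
  shows "I \<subseteq> J"
  unfolding generated by (rule mem_genideal_ring_of(3)) (use assms in auto)

text \<open>
  A prime over \<open>I\<close> contains a variable from each generator, hence it contains the prime \<open>P\<^sub>C\<close> generated
  by the variables that it contains, and \<open>P\<^sub>C\<close> contains \<open>I\<close>.
\<close>

lemma minimal_primes_eq: "minimal_primes I = coordinate_prime ` minimal_covers"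
proof -
  have "\<exists>C. p = coordinate_prime C" if p: "p \<in> minimal_primes I" for p
  proof -
    have prime: "primeideal p (ring_of TYPE(('x, 'k) mpoly))" and "I \<subseteq> p"
      and min: "\<And>q. primeideal q (ring_of TYPE(('x, 'k) mpoly)) \<Longrightarrow> I \<subseteq> q \<Longrightarrow> q \<subseteq> p \<Longrightarrow> q = p"
      using p by (auto simp: minimal_primes_def)
    define C where "C = {i. monomial (variable i) \<in> p}"
    have "I \<subseteq> coordinate_prime C"
    proof (rule I_subset[OF ideal_coordinate_power])
      fix a assume "a \<in> A"
      then have "monomial a \<in> p" using generator_mem \<open>I \<subseteq> p\<close> by blast
      then obtain i where "0 < Poly_Mapping.lookup a i" "i \<in> C"
        using prime_contains_some_variable[OF prime] by (auto simp: C_def)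
      moreover have "Poly_Mapping.lookup a i \<le> weight C a"
        unfolding weight_def by (rule member_le_sum) (use calculation in auto)
      ultimately show "monomial a \<in> coordinate_prime C"
        by (simp add: monomial_mem_coordinate_power)
    qed
    moreover have "coordinate_prime C \<subseteq> p"
      by (rule coordinate_prime_subset) (use prime in \<open>auto simp: primeideal_ring_of_iff C_def\<close>)
    ultimately show ?thesis
      using min[OF primeideal_coordinate_prime] by metis
  qed
  then show ?thesis
    unfolding minimal_covers_def by blast
qed

lemma I_subset_coordinate_prime: "C \<in> minimal_covers \<Longrightarrow> I \<subseteq> coordinate_prime C"
  by (auto simp: minimal_covers_def minimal_primes_def)

text \<open>
  If every generator met \<open>C - {i}\<close>, then \<open>C\<close> would not be minimal.
\<close>

lemma generator_meeting_cover_once: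
  assumes C: "C \<in> minimal_covers" and i: "i \<in> C"
  obtains a where "a \<in> A" "Poly_Mapping.lookup a i = 1" "\<And>j. j \<in> C \<Longrightarrow> j \<noteq> i \<Longrightarrow> Poly_Mapping.lookup a j = 0"
proof -
  have w: "weight C a = Poly_Mapping.lookup a i + weight (C - {i}) a" for a
    unfolding weight_def using i by (simp add: sum.remove)
  have "\<not> I \<subseteq> coordinate_prime (C - {i})"
  proof
    assume "I \<subseteq> coordinate_prime (C - {i})"
    moreover have "coordinate_prime (C - {i}) \<subseteq> (coordinate_prime C :: ('x, 'k) mpoly set)"
      by (auto simp: coordinate_power_def w intro: trans_le_add2)
    ultimately have "coordinate_prime (C - {i}) = (coordinate_prime C :: ('x, 'k) mpoly set)"
      using C primeideal_coordinate_prime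
      unfolding minimal_covers_def minimal_primes_def mem_Collect_eq by blast
    moreover have "(monomial (variable i) :: ('x, 'k) mpoly) \<in> coordinate_prime C"
      "(monomial (variable i) :: ('x, 'k) mpoly) \<notin> coordinate_prime (C - {i})"
      using i by (simp_all add: monomial_mem_coordinate_power weight_variable)
    ultimately show False by simp
  qed
  then obtain a where a: "a \<in> A" "(monomial a :: ('x, 'k) mpoly) \<notin> coordinate_prime (C - {i})"
    using I_subset[OF ideal_coordinate_power] by blast
  then have w0: "weight (C - {i}) a = 0"
    by (simp add: monomial_mem_coordinate_power)
  have "(monomial a :: ('x, 'k) mpoly) \<in> coordinate_prime C"
    using I_subset_coordinate_prime[OF C] generator_mem[OF a(1)] by blast
  then have "1 \<le> Poly_Mapping.lookup a i"
    using w0 w[of a] by (simp add: monomial_mem_coordinate_power)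
  then have "Poly_Mapping.lookup a i = 1"
    using squarefree[OF a(1), of i] by simp
  moreover have "Poly_Mapping.lookup a j = 0" if "j \<in> C" "j \<noteq> i" for j
    using w0 that by (simp add: weight_def)
  ultimately show ?thesis using that[of a] a(1) by blast
qed

text \<open>
  Locally at \<open>P\<^sub>C\<close> the ideal \<open>I\<close> contains every variable of \<open>C\<close>: a generator that meets \<open>C\<close> only in \<open>i\<close> is
  the variable \<open>i\<close> times a monomial that is a unit at \<open>P\<^sub>C\<close>.  The product of these units over \<open>i \<in> C\<close>
  serves all variables at once.
\<close>

lemma common_multiplier:
  assumes C: "C \<in> minimal_covers"
  obtains g where "g \<notin> coordinate_prime C" "\<And>i. i \<in> C \<Longrightarrow> g * monomial (variable i) \<in> I"
proof -
  have "\<exists>b. weight C b = 0 \<and> (monomial b * monomial (variable i) :: ('x, 'k) mpoly) \<in> I" if "i \<in> C" for i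
  proof -
    obtain a where a: "a \<in> A" "Poly_Mapping.lookup a i = 1" "\<And>j. j \<in> C \<Longrightarrow> j \<noteq> i \<Longrightarrow> Poly_Mapping.lookup a j = 0"
      using generator_meeting_cover_once[OF C \<open>i \<in> C\<close>] by blast
    then obtain b where b: "a = variable i + b"
      using split_off_variable[of a i] by auto
    have "Poly_Mapping.lookup b j = 0" if "j \<in> C" for j
      using a(2) a(3)[of j] that by (cases "j = i") (auto simp: b lookup_add variable_def lookup_single)
    then have "weight C b = 0"
      by (simp add: weight_def)
    moreover have "(monomial b * monomial (variable i) :: ('x, 'k) mpoly) \<in> I"
      using generator_mem[OF a(1)] by (simp add: b monomial_add mult.commute)
    ultimately show ?thesis by blast
  qed
  then obtain b where b: "\<And>i. i \<in> C \<Longrightarrow> weight C (b i) = 0"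
    "\<And>i. i \<in> C \<Longrightarrow> (monomial (b i) * monomial (variable i) :: ('x, 'k) mpoly) \<in> I"
    by metis
  define g :: "('x, 'k) mpoly" where "g = (\<Prod>i\<in>C. monomial (b i))"
  have "g \<notin> coordinate_prime C"
    unfolding g_def using prime_prod_mem[OF primeideal_coordinate_prime] b(1)
    by (fastforce simp: monomial_mem_coordinate_power)
  moreover have "g * monomial (variable i) \<in> I" if "i \<in> C" for i
  proof -
    have "g * monomial (variable i) = (\<Prod>i\<in>C - {i}. monomial (b i)) * (monomial (b i) * monomial (variable i))"
      unfolding g_def using that by (subst prod.remove[of _ i]) (auto simp: ac_simps)
    then show ?thesis
      using b(2)[OF that] idealD[OF ideal_I] by metis
  qed
  ultimately show ?thesis using that by blast
qed

text \<open>
  One inclusion holds because \<open>P\<^sub>C\<^sup>s\<close> is \<open>P\<^sub>C\<close>-primary and contains \<open>I\<^sup>s\<close>.  For the other one, the \<open>s\<close>-th power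
  of the common multiplier carries every monomial of weight at least \<open>s\<close> on \<open>C\<close> into \<open>I\<^sup>s\<close>.
\<close>

lemma contract_extend_ideal_power:
  assumes C: "C \<in> minimal_covers"
  shows "contract (extend (coordinate_prime C) (ideal_power I s)) = coordinate_power C s"
proof -
  have "ideal_power I s \<subseteq> coordinate_power C s"
  proof (induction s)
    case (Suc s)
    show ?case
    proof (rule ideal_power_Suc_subset[OF ideal_coordinate_power])
      fix a b assume "a \<in> ideal_power I s" "b \<in> I"
      then show "a * b \<in> coordinate_power C (Suc s)"
        using Suc I_subset_coordinate_prime[OF C] coordinate_power_mult[of a C s b "Suc 0"] by auto
    qed
  qed (simp add: coordinate_power_0)
  then have "f \<in> coordinate_power C s" if "g \<notin> coordinate_prime C" "g * f \<in> ideal_power I s" for f g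
    using coordinate_power_primary that by blast
  moreover have "\<exists>g. g \<notin> coordinate_prime C \<and> g * f \<in> ideal_power I s" if f: "f \<in> coordinate_power C s" for f
  proof -
    obtain g where g: "g \<notin> coordinate_prime C" "\<And>i. i \<in> C \<Longrightarrow> g * monomial (variable i) \<in> I"
      using common_multiplier[OF C] by blast
    have mono: "g ^ s * monomial a \<in> ideal_power I s" if "s \<le> weight C a" for a
      using that
    proof (induction s arbitrary: a)
      case (Suc s)
      then obtain i where i: "i \<in> C" "0 < Poly_Mapping.lookup a i"
        by (metis weight_def sum.neutral not_gr_zero not_less_eq_eq zero_le)
      then obtain b where b: "a = variable i + b"
        using split_off_variable by metis
      then have "s \<le> weight C b"
        using Suc.prems i(1) by (simp add: weight_add weight_variable)
      then have "(g ^ s * monomial b) * (g * monomial (variable i)) \<in> ideal_power I (Suc s)"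
        using Suc.IH g(2)[OF i(1)] by (intro mult_mem_ideal_power_Suc)
      then show ?case
        by (simp add: b monomial_add ac_simps)
    qed (simp add: ideal_power_0)
    have "g ^ s * f \<in> ideal_power I s"
      by (rule mult_mem_ideal_if_monomials[OF ideal_ideal_power[OF ideal_I]])
        (use f mono in \<open>auto simp: coordinate_power_def\<close>)
    moreover have "g ^ s \<notin> coordinate_prime C"
      using g(1) prime_power_mem[OF primeideal_coordinate_prime] by blast
    ultimately show ?thesis by blast
  qed
  ultimately show ?thesis
    unfolding contract_extend[OF primeideal_coordinate_prime ideal_ideal_power[OF ideal_I]] by blast
qed

lemma symbolic_power_eq: "symbolic_power I s = (\<Inter>C\<in>minimal_covers. coordinate_power C s)"
  unfolding symbolic_power_def minimal_primes_eq by (simp add: contract_extend_ideal_power)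

text \<open>
  For a single cover, \<open>P\<^sub>C\<^sup>s : x\<^sup>a\<close> is the whole ring if \<open>C\<close> has weight at least \<open>s\<close>, and otherwise it is
  \<open>P\<^sub>C\<close>-primary.
\<close>

lemma radical_colon_symbolic_power:
  "radical (colon (symbolic_power I s) (monomial a)) =
    (\<Inter>C\<in>{C\<in>minimal_covers. weight C a < s}. coordinate_prime C)"
proof (intro subset_antisym subsetI)
  fix g assume "g \<in> radical (colon (symbolic_power I s) (monomial a))"
  then obtain m where "g ^ m * monomial a \<in> symbolic_power I s"
    by (auto simp: radical_def colon_def)
  then have mem: "g ^ m * monomial a \<in> coordinate_power C s" if "C \<in> minimal_covers" for C
    using that by (simp add: symbolic_power_eq)
  have "g \<in> coordinate_prime C" if "C \<in> minimal_covers" "weight C a < s" for C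
  proof (rule prime_power_mem[OF primeideal_coordinate_prime], rule ccontr)
    assume "g ^ m \<notin> coordinate_prime C"
    then show False
      using coordinate_power_primary mem that by (force simp: monomial_mem_coordinate_power)
  qed
  then show "g \<in> (\<Inter>C\<in>{C\<in>minimal_covers. weight C a < s}. coordinate_prime C)" by blast
next
  fix g :: "('x, 'k) mpoly"
  assume g: "g \<in> (\<Inter>C\<in>{C\<in>minimal_covers. weight C a < s}. coordinate_prime C)"
  \<comment> \<open>The exponent is \<open>Suc s\<close> and not \<open>s\<close> because the radical asks for a positive one.\<close>
  have "g ^ Suc s * monomial a \<in> coordinate_power C s" if "C \<in> minimal_covers" for C
  proof (cases "weight C a < s")
    case True
    then have "g ^ Suc s \<in> coordinate_power C (Suc s)"
      using g that by (intro power_mem_coordinate_power) auto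
    then have "g ^ Suc s * monomial a \<in> coordinate_power C (Suc s + 0)"
      by (rule coordinate_power_mult) (simp add: coordinate_power_0)
    then show ?thesis using coordinate_power_antimono[of s "Suc s" C] by auto
  next
    case False
    then have "monomial a \<in> (coordinate_power C s :: ('x, 'k) mpoly set)"
      by (simp add: monomial_mem_coordinate_power)
    then show ?thesis using idealD[OF ideal_coordinate_power] by blast
  qed
  then have "g ^ Suc s * monomial a \<in> symbolic_power I s"
    by (simp add: symbolic_power_eq)
  then show "g \<in> radical (colon (symbolic_power I s) (monomial a))"
    unfolding radical_def colon_def by blast
qed

text \<open>
  The empty family is left out because it comes from the monomials in the symbolic power.
\<close>

definition light_families :: "nat \<Rightarrow> 'x set set set"
  where "light_families s = {{C\<in>minimal_covers. weight C a < s} | a. True} - {{}}"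

lemma assrad_symbolic_power:
  "assrad (symbolic_power I s) = (\<lambda>F. \<Inter>C\<in>F. coordinate_prime C) ` light_families s"
proof -
  have "monomial a \<notin> symbolic_power I s \<longleftrightarrow> {C\<in>minimal_covers. weight C a < s} \<noteq> {}" for a
    by (auto simp: symbolic_power_eq monomial_mem_coordinate_power not_le)
  then show ?thesis
    unfolding assrad_def radical_colon_symbolic_power light_families_def by blast
qed

text \<open>
  \<open>P\<^sub>C\<close> is the annihilator of the product of the variables outside \<open>C\<close>.  A monomial with a variable \<open>i \<in> C\<close>
  times this product is divisible by the square-free generator that meets \<open>C\<close> only in \<open>i\<close>.
\<close>

lemma coordinate_prime_associated:
  assumes C: "C \<in> minimal_covers"
  shows "(coordinate_prime C :: ('x, 'k) mpoly set) \<in> associated_primes I"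
proof -
  define e :: "'x \<Rightarrow>\<^sub>0 nat" where "e = (\<Sum>i\<in>- C. variable i)"
  have e: "Poly_Mapping.lookup e i = of_bool (i \<notin> C)" for i
    by (simp add: e_def lookup_sum variable_def lookup_single when_def)
  have "coordinate_prime C = colon I (monomial e)"
  proof (intro subset_antisym subsetI)
    fix f :: "('x, 'k) mpoly" assume f: "f \<in> coordinate_prime C"
    have "monomial e * f \<in> I"
    proof (rule mult_mem_ideal_if_monomials[OF ideal_I])
      fix b assume "b \<in> Poly_Mapping.keys f"
      then have "1 \<le> weight C b" using f by (simp add: coordinate_power_def)
      then obtain i where i: "i \<in> C" "0 < Poly_Mapping.lookup b i"
        by (metis weight_def sum.neutral not_gr_zero not_one_le_zero)
      obtain a where a: "a \<in> A" "Poly_Mapping.lookup a i = 1"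
          "\<And>j. j \<in> C \<Longrightarrow> j \<noteq> i \<Longrightarrow> Poly_Mapping.lookup a j = 0"
        using generator_meeting_cover_once[OF C i(1)] by blast
      have "Poly_Mapping.lookup a j \<le> Poly_Mapping.lookup (e + b) j" for j
        using a(2) a(3)[of j] squarefree[OF a(1), of j] i
        by (cases "j = i"; cases "j \<in> C") (auto simp: lookup_add e)
      then have "e + b = (e + b - a) + a"
        by (intro poly_mapping_eqI) (metis lookup_add lookup_minus le_add_diff_inverse2)
      then have "monomial e * monomial b = (monomial (e + b - a) * monomial a :: ('x, 'k) mpoly)"
        by (metis monomial_add)
      then show "monomial e * monomial b \<in> I"
        using generator_mem[OF a(1)] idealD[OF ideal_I] by metis
    qed
    then show "f \<in> colon I (monomial e)" by (simp add: colon_def mult.commute)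
  next
    fix f :: "('x, 'k) mpoly" assume "f \<in> colon I (monomial e)"
    then have "monomial e * f \<in> coordinate_prime C"
      using I_subset_coordinate_prime[OF C] by (auto simp: colon_def mult.commute)
    moreover have "(monomial e :: ('x, 'k) mpoly) \<notin> coordinate_prime C"
      by (simp add: monomial_mem_coordinate_power weight_def e)
    ultimately show "f \<in> coordinate_prime C"
      by (rule coordinate_power_primary)
  qed
  then show ?thesis
    using primeideal_coordinate_prime unfolding associated_primes_def by blast
qed

text \<open>
  The finiteness of the heights matters: \<open>the_enat\<close> has no specified value at infinity.
\<close>

lemma card_le_bight:
  assumes "C \<in> minimal_covers"
  shows "card C \<le> the_enat (bight I)"
proof -
  have "enat (card C) \<le> bight I"
    using height_coordinate_prime[of C] SUP_upper[OF coordinate_prime_associated[OF assms], of height]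
    unfolding bight_def by (rule order_trans)
  moreover have "bight I \<le> enat CARD('x)"
    unfolding bight_def by (rule SUP_least) (rule height_le_card)
  ultimately show ?thesis
    by (cases "bight I") auto
qed

text \<open>
  A nonzero ideal has no empty cover, since \<open>P\<^sub>C\<close> for the empty set \<open>C\<close> is the zero ideal; so the minimal
  covers satisfy the hypotheses of \<open>light_families_persist\<close>, which gives both inclusions.
\<close>

lemma light_families_eq:
  assumes "I \<noteq> {0}"
    and s: "real CARD('x) * real (the_enat (bight I)) powr ((real CARD('x) + 2) / 2) \<le> real s"
    and t: "real CARD('x) * real (the_enat (bight I)) powr ((real CARD('x) + 2) / 2) \<le> real t"
  shows "light_families s = light_families t"
proof -
  have "C \<noteq> {}" if "C \<in> minimal_covers" for C
  proof
    assume "C = {}"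
    then have "f = 0" if "f \<in> I" for f
      using I_subset_coordinate_prime[OF \<open>C \<in> minimal_covers\<close>] that
      by (auto simp: coordinate_power_def weight_def)
    then show False using \<open>I \<noteq> {0}\<close> idealD[OF ideal_I] by auto
  qed
  then have size: "C \<noteq> {} \<and> card C \<le> the_enat (bight I)" if "C \<in> minimal_covers" for C
    using that card_le_bight by blast
  have "light_families t \<subseteq> light_families s"
    if s: "real CARD('x) * real (the_enat (bight I)) powr ((real CARD('x) + 2) / 2) \<le> real s" for s t
  proof
    fix F assume "F \<in> light_families t"
    then obtain a where F: "F = {C\<in>minimal_covers. weight C a < t}" "F \<noteq> {}"
      by (auto simp: light_families_def)
    have "{C \<in> minimal_covers. sum (Poly_Mapping.lookup a) C < t} \<noteq> {}"
      using F by (simp add: weight_def)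
    then obtain b where "{C \<in> minimal_covers. sum b C < s} = {C \<in> minimal_covers. sum (Poly_Mapping.lookup a) C < t}"
      using light_families_persist[where \<C> = minimal_covers and h = "the_enat (bight I)" and s = s, OF _ s] size
      by blast
    then have b: "{C \<in> minimal_covers. sum b C < s} = F"
      using F(1) by (simp add: weight_def)
    have "sum b C = weight C (Abs_poly_mapping b)" for C
      by (simp add: weight_def)
    then show "F \<in> light_families s"
      using b F(2) by (auto simp: light_families_def)
  qed
  then show ?thesis using s t by blast
qed

end

section \<open>Stability of the associated radicals\<close>

theorem theorem2:
  fixes I :: "('x::{finite,linorder}, 'k::field) mpoly set"
    and n s\<^sub>0 :: nat
  assumes "squarefree_monomial_ideal I"
    and "I \<noteq> {0}"
    and "I \<noteq> UNIV"
    and "n = CARD('x)"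
    and "s\<^sub>0 = nat \<lceil>real n * real (the_enat (bight I)) powr ((real n + 2) / 2)\<rceil>"
  shows "(\<forall>s\<ge>s\<^sub>0. assrad (symbolic_power I s) = assrad (symbolic_power I s\<^sub>0)) \<and>
         (\<exists>C. \<forall>\<^sub>F s in sequentially. assrad (symbolic_power I s) = C)"
proof -
  obtain A where "\<forall>a\<in>A. \<forall>i. Poly_Mapping.lookup a i \<le> 1"
      "I = Idl\<^bsub>ring_of TYPE(('x, 'k) mpoly)\<^esub> (monomial ` A)"
    using assms(1) unfolding squarefree_monomial_ideal_def by blast
  then interpret squarefree_generators A I
    by (intro squarefree_generators.intro) blast+
  have bound: "real CARD('x) * real (the_enat (bight I)) powr ((real CARD('x) + 2) / 2) \<le> real s"
    if "s\<^sub>0 \<le> s" for s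
    using that unfolding assms(4,5) by (simp add: ceiling_le_iff nat_le_iff)
  have stable: "assrad (symbolic_power I s) = assrad (symbolic_power I s\<^sub>0)" if "s\<^sub>0 \<le> s" for s
    unfolding assrad_symbolic_power
    using light_families_eq[OF assms(2) bound[OF that] bound[OF order_refl]] by simp
  then show ?thesis
    unfolding eventually_sequentially by blast
qed

end
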